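(* Let $A$ be a Banach algebra, $X$ a Banach $A$-bimodule, $n\ge 0$ an even integer, and let $T,S:A^{(n)}\to A^{(n)}$ be continuous linear mappings. Suppose that for every $x^{(n+2)}\in X^{(n+2)}$ the mapping $a^{(n+2)}\mapsto x^{(n+2)}T''(a^{(n+2)})$ from $A^{(n+2)}$ to $X^{(n+2)}$ is weak$^*$-to-weak continuous. If $D:A^{(n)}\to X^{(n+1)}$ is a $T$-$S$-derivation, then $D'':A^{(n+2)}\to X^{(n+3)}$ is a $T''$-$S''$-derivation.
   Context: Notation: $A^{(n)}$, $X^{(n)}$ are the $n$-th duals, $A^{(0)}=A$, $X^{(0)}=X$; $D''$, $T''$, $S''$ are second adjoints. For a Banach algebra $B$ and a Banach $B$-bimodule $Y$, the dual $Y^*$ is a Banach $B$-bimodule via $\langle by',y\rangle=\langle y',yb\rangle$, $\langle y'b,y\rangle=\langle y',by\rangle$. The second dual $B^{**}$ carries the first Arens product: $\langle b''a',a\rangle=\langle b'',a'a\rangle$ and $\langle a''b'',a'\rangle=\langle a'',b''a'\rangle$, where $\langle a'a,b\rangle=\langle a',ab\rangle$. With it, $Y^{**}$ is a Banach $B^{**}$-bimodule via $b''y''=w^*\text{-}\lim_i\lim_j b_iy_j$ and $y''b''=w^*\text{-}\lim_j\lim_i y_jb_i$, for nets $(b_i)\subseteq B$, $(y_j)\subseteq Y$ converging weak$^*$ to $b''$, $y''$ respectively (iterated weak$^*$ limits, the inner limit being taken first). For even $n$, $A^{(n+2)}=(A^{(n)})^{**}$ and $X^{(n+2)}=(X^{(n)})^{**}$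 get their algebra and $A^{(n+2)}$-bimodule structures inductively this way; $X^{(n+1)}$ is the dual $A^{(n)}$-bimodule of $X^{(n)}$ and $X^{(n+3)}$ is the dual $A^{(n+2)}$-bimodule of $X^{(n+2)}$. Definition: for continuous linear maps $T,S:B\to B$, a bounded linear map $D:B\to Y$ is a $T$-$S$-derivation if $D(xy)=T(x)D(y)+D(x)S(y)$ for all $x,y\in B$. *)

theory Defs
  imports "HOL-Analysis.Analysis"
begin

text \<open>
  The type of the scalars is an arbitrary \<open>'k :: real_normed_field\<close>, that is, the reals or the
  complex numbers. A normed space over \<open>'k\<close> is a linear subspace \<open>E\<close> of a type of class
  \<open>real_normed_vector\<close> that carries a multiplication by scalars from \<open>'k\<close>, with the norm of that type.
\<close>

definition banach_space ::
  "('k::real_normed_field \<Rightarrow> 'v::real_normed_vector \<Rightarrow> 'v) \<Rightarrow> 'v set \<Rightarrow> bool" where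
  "banach_space s E \<longleftrightarrow>
     vector_space s \<and> (\<forall>c x. norm (s c x) = norm c * norm x) \<and>
     module.subspace s E \<and> complete E"

definition linear_map_on ::
  "('k::real_normed_field \<Rightarrow> 'v::real_normed_vector \<Rightarrow> 'v) \<Rightarrow>
   ('k \<Rightarrow> 'w::real_normed_vector \<Rightarrow> 'w) \<Rightarrow> 'v set \<Rightarrow> 'w set \<Rightarrow> ('v \<Rightarrow> 'w) \<Rightarrow> bool" where
  "linear_map_on s t E F f \<longleftrightarrow>
     (\<forall>x\<in>E. f x \<in> F) \<and>
     (\<forall>x\<in>E. \<forall>y\<in>E. f (x + y) = f x + f y) \<and>
     (\<forall>c. \<forall>x\<in>E. f (s c x) = t c (f x))"

definition bounded_linear_map_on ::
  "('k::real_normed_field \<Rightarrow> 'v::real_normed_vector \<Rightarrow> 'v) \<Rightarrow>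
   ('k \<Rightarrow> 'w::real_normed_vector \<Rightarrow> 'w) \<Rightarrow> 'v set \<Rightarrow> 'w set \<Rightarrow> ('v \<Rightarrow> 'w) \<Rightarrow> bool" where
  "bounded_linear_map_on s t E F f \<longleftrightarrow>
     linear_map_on s t E F f \<and> (\<exists>K. \<forall>x\<in>E. norm (f x) \<le> K * norm x)"

definition bounded_bilinear_map_on ::
  "('k::real_normed_field \<Rightarrow> 'v::real_normed_vector \<Rightarrow> 'v) \<Rightarrow>
   ('k \<Rightarrow> 'w::real_normed_vector \<Rightarrow> 'w) \<Rightarrow> ('k \<Rightarrow> 'z::real_normed_vector \<Rightarrow> 'z) \<Rightarrow>
   'v set \<Rightarrow> 'w set \<Rightarrow> 'z set \<Rightarrow> ('v \<Rightarrow> 'w \<Rightarrow> 'z) \<Rightarrow> bool" where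
  "bounded_bilinear_map_on s t u E F G f \<longleftrightarrow>
     (\<forall>x\<in>E. linear_map_on t u F G (\<lambda>y. f x y)) \<and>
     (\<forall>y\<in>F. linear_map_on s u E G (\<lambda>x. f x y)) \<and>
     (\<exists>K. \<forall>x\<in>E. \<forall>y\<in>F. norm (f x y) \<le> K * norm x * norm y)"

definition banach_algebra ::
  "('k::real_normed_field \<Rightarrow> 'a::real_normed_vector \<Rightarrow> 'a) \<Rightarrow> 'a set \<Rightarrow> ('a \<Rightarrow> 'a \<Rightarrow> 'a) \<Rightarrow> bool" where
  "banach_algebra s B m \<longleftrightarrow>
     banach_space s B \<and> bounded_bilinear_map_on s s s B B B m \<and>
     (\<forall>x\<in>B. \<forall>y\<in>B. \<forall>z\<in>B. m (m x y) z = m x (m y z)) \<and>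
     (\<forall>x\<in>B. \<forall>y\<in>B. norm (m x y) \<le> norm x * norm y)"

definition banach_bimodule ::
  "('k::real_normed_field \<Rightarrow> 'a::real_normed_vector \<Rightarrow> 'a) \<Rightarrow> 'a set \<Rightarrow> ('a \<Rightarrow> 'a \<Rightarrow> 'a) \<Rightarrow>
   ('k \<Rightarrow> 'x::real_normed_vector \<Rightarrow> 'x) \<Rightarrow> 'x set \<Rightarrow> ('a \<Rightarrow> 'x \<Rightarrow> 'x) \<Rightarrow> ('x \<Rightarrow> 'a \<Rightarrow> 'x) \<Rightarrow> bool" where
  "banach_bimodule s B m t Y l r \<longleftrightarrow>
     banach_space t Y \<and>
     bounded_bilinear_map_on s t t B Y Y l \<and> bounded_bilinear_map_on t s t Y B Y r \<and>
     (\<forall>a\<in>B. \<forall>b\<in>B. \<forall>y\<in>Y. l (m a b) y = l a (l b y)) \<and>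
     (\<forall>a\<in>B. \<forall>b\<in>B. \<forall>y\<in>Y. r y (m a b) = r (r y a) b) \<and>
     (\<forall>a\<in>B. \<forall>b\<in>B. \<forall>y\<in>Y. r (l a y) b = l a (r y b))"

text \<open>
  \<open>T\<close>-\<open>S\<close>-derivations from an algebra \<open>B\<close> with product \<open>m\<close> to a bimodule \<open>Y\<close> with actions \<open>l\<close>, \<open>r\<close>.
\<close>

definition TS_derivation ::
  "('k::real_normed_field \<Rightarrow> 'a::real_normed_vector \<Rightarrow> 'a) \<Rightarrow> 'a set \<Rightarrow> ('a \<Rightarrow> 'a \<Rightarrow> 'a) \<Rightarrow>
   ('k \<Rightarrow> 'x::real_normed_vector \<Rightarrow> 'x) \<Rightarrow> 'x set \<Rightarrow> ('a \<Rightarrow> 'x \<Rightarrow> 'x) \<Rightarrow> ('x \<Rightarrow> 'a \<Rightarrow> 'x) \<Rightarrow>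
   ('a \<Rightarrow> 'a) \<Rightarrow> ('a \<Rightarrow> 'a) \<Rightarrow> ('a \<Rightarrow> 'x) \<Rightarrow> bool" where
  "TS_derivation s B m t Y l r T S D \<longleftrightarrow>
     linear_map_on s s B B T \<and> continuous_on B T \<and>
     linear_map_on s s B B S \<and> continuous_on B S \<and>
     bounded_linear_map_on s t B Y D \<and>
     (\<forall>x\<in>B. \<forall>y\<in>B. D (m x y) = l (T x) (D y) + r (D x) (S y))"


text \<open>
  Since the height of the tower of duals is a variable, the duals cannot be formed as types.
  Instead all of them are subspaces of one ambient type: \<open>level A k\<close> is the \<open>k\<close>-th dual of
  \<open>level A 0\<close>, and \<open>pairing A k u x\<close> is the value of the functional \<open>u \<in> level A (Suc k)\<close> at
  \<open>x \<in> level A k\<close>. For any Banach space and any height there is such a tower: take as ambient type the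
  Euclidean product of the finitely many duals, and as levels the factors. The height has to be
  bounded, as for a nonreflexive space no type is large enough to contain all iterated duals.
\<close>

record ('k, 'v) tower =
  scal :: "'k \<Rightarrow> 'v \<Rightarrow> 'v"
  level :: "nat \<Rightarrow> 'v set"
  pairing :: "nat \<Rightarrow> 'v \<Rightarrow> 'v \<Rightarrow> 'k"

text \<open>
  \<open>E'\<close> is the dual of \<open>E\<close>: \<open>p\<close> identifies \<open>E'\<close>, linearly and isometrically, with the space of
  all bounded linear functionals on \<open>E\<close> with the operator norm.
\<close>

definition is_dual ::
  "('k::real_normed_field \<Rightarrow> 'v::real_normed_vector \<Rightarrow> 'v) \<Rightarrow> 'v set \<Rightarrow> 'v set \<Rightarrow> ('v \<Rightarrow> 'v \<Rightarrow> 'k) \<Rightarrow> bool"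
  where
  "is_dual s E E' p \<longleftrightarrow>
     module.subspace s E' \<and>
     (\<forall>u\<in>E'. bounded_linear_map_on s (*) E UNIV (p u)) \<and>
     (\<forall>x\<in>E. linear_map_on s (*) E' UNIV (\<lambda>u. p u x)) \<and>
     (\<forall>u\<in>E'. norm u = (SUP x\<in>{x\<in>E. norm x \<le> 1}. norm (p u x))) \<and>
     (\<forall>f. bounded_linear_map_on s (*) E UNIV f \<longrightarrow> (\<exists>u\<in>E'. \<forall>x\<in>E. p u x = f x))"

definition dual_tower :: "nat \<Rightarrow> ('k::real_normed_field, 'v::real_normed_vector) tower \<Rightarrow> bool" where
  "dual_tower N A \<longleftrightarrow>
     banach_space (scal A) (level A 0) \<and>
     (\<forall>k<N. is_dual (scal A) (level A k) (level A (Suc k)) (pairing A k))"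

text \<open>The element of \<open>level A (Suc k)\<close> that represents the functional \<open>f\<close> on \<open>level A k\<close>.\<close>

definition rep :: "('k, 'v) tower \<Rightarrow> nat \<Rightarrow> ('v \<Rightarrow> 'k) \<Rightarrow> 'v" where
  "rep A k f = (THE u. u \<in> level A (Suc k) \<and> (\<forall>x\<in>level A k. pairing A k u x = f x))"

definition canon :: "('k, 'v) tower \<Rightarrow> nat \<Rightarrow> 'v \<Rightarrow> 'v" where
  "canon A k x = rep A (Suc k) (\<lambda>u. pairing A k u x)"

text \<open>
  For \<open>T\<close> from \<open>level A i\<close> to \<open>level B j\<close> the adjoint maps \<open>level B (Suc j)\<close> to \<open>level A (Suc i)\<close>, and the
  second adjoint maps \<open>level A (i + 2)\<close> to \<open>level B (j + 2)\<close>.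
\<close>

definition adj ::
  "('k, 'v) tower \<Rightarrow> nat \<Rightarrow> ('k, 'w) tower \<Rightarrow> nat \<Rightarrow> ('v \<Rightarrow> 'w) \<Rightarrow> 'w \<Rightarrow> 'v" where
  "adj A i B j T v = rep A i (\<lambda>x. pairing B j v (T x))"

definition adj2 ::
  "('k, 'v) tower \<Rightarrow> nat \<Rightarrow> ('k, 'w) tower \<Rightarrow> nat \<Rightarrow> ('v \<Rightarrow> 'w) \<Rightarrow> 'v \<Rightarrow> 'w" where
  "adj2 A i B j T = adj B (Suc j) A (Suc i) (adj A i B j T)"


definition initial_topology :: "'v set \<Rightarrow> ('v \<Rightarrow> 'k::topological_space) set \<Rightarrow> 'v topology" where
  "initial_topology E \<Phi> = topology_generated_by {{x\<in>E. f x \<in> U} |f U. f \<in> \<Phi> \<and> open U}"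

definition weak_topology ::
  "('k::topological_space, 'v) tower \<Rightarrow> nat \<Rightarrow> 'v topology" where
  "weak_topology A k = initial_topology (level A k) ((\<lambda>u x. pairing A k u x) ` level A (Suc k))"

text \<open>The weak* topology on \<open>level A (Suc k)\<close>, the dual of \<open>level A k\<close>.\<close>

definition weak_star_topology ::
  "('k::topological_space, 'v) tower \<Rightarrow> nat \<Rightarrow> 'v topology" where
  "weak_star_topology A k =
     initial_topology (level A (Suc k)) ((\<lambda>x u. pairing A k u x) ` level A k)"


text \<open>The actions of an algebra on the dual \<open>level X (Suc k)\<close> of the bimodule \<open>level X k\<close>.\<close>

definition dual_left :: "('k, 'x) tower \<Rightarrow> nat \<Rightarrow> ('x \<Rightarrow> 'a \<Rightarrow> 'x) \<Rightarrow> 'a \<Rightarrow> 'x \<Rightarrow> 'x" where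
  "dual_left X k r b u = rep X k (\<lambda>x. pairing X k u (r x b))"

definition dual_right :: "('k, 'x) tower \<Rightarrow> nat \<Rightarrow> ('a \<Rightarrow> 'x \<Rightarrow> 'x) \<Rightarrow> 'x \<Rightarrow> 'a \<Rightarrow> 'x" where
  "dual_right X k l u b = rep X k (\<lambda>x. pairing X k u (l b x))"

text \<open>
  The first Arens product on \<open>level A (k + 2)\<close> that extends a product \<open>m\<close> on \<open>level A k\<close>;
  \<open>arens_left A k m b a'\<close> is the auxiliary product of \<open>b\<close> in the second dual with \<open>a'\<close> in the first.
\<close>

definition arens_left :: "('k, 'a) tower \<Rightarrow> nat \<Rightarrow> ('a \<Rightarrow> 'a \<Rightarrow> 'a) \<Rightarrow> 'a \<Rightarrow> 'a \<Rightarrow> 'a" where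
  "arens_left A k m b a' = rep A k (\<lambda>a. pairing A (Suc k) b (dual_right A k m a' a))"

definition arens :: "('k, 'a) tower \<Rightarrow> nat \<Rightarrow> ('a \<Rightarrow> 'a \<Rightarrow> 'a) \<Rightarrow> 'a \<Rightarrow> 'a \<Rightarrow> 'a" where
  "arens A k m a b = rep A (Suc k) (\<lambda>a'. pairing A (Suc k) a (arens_left A k m b a'))"

text \<open>
  Nets in \<open>level A k\<close> are represented by their filters of tails: \<open>weak_star_net A k F a\<close> states
  that the net given by \<open>F\<close> lies in \<open>level A k\<close> and, through the canonical embedding, converges weak*
  to the element \<open>a\<close> of \<open>level A (k + 2)\<close>.
\<close>

definition weak_star_net ::
  "('k::topological_space, 'v) tower \<Rightarrow> nat \<Rightarrow> 'v filter \<Rightarrow> 'v \<Rightarrow> bool" where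
  "weak_star_net A k F a \<longleftrightarrow>
     F \<noteq> bot \<and> (\<forall>\<^sub>F x in F. x \<in> level A k) \<and>
     limitin (weak_star_topology A (Suc k)) (canon A k) a F"

text \<open>
  The actions on \<open>level X (k + 2)\<close>, as the common value of the iterated weak* limits over all nets
  converging to the two arguments. The inner limit is \<open>w\<close>: in the left action it is over the net
  \<open>G\<close> in the module, in the right action over the net \<open>F\<close> in the algebra.
\<close>

definition ext_left ::
  "('k::topological_space, 'a) tower \<Rightarrow> ('k, 'x) tower \<Rightarrow> nat \<Rightarrow> ('a \<Rightarrow> 'x \<Rightarrow> 'x) \<Rightarrow> 'a \<Rightarrow> 'x \<Rightarrow> 'x" where
  "ext_left A X k l b y =
     (THE z. \<forall>F G. weak_star_net A k F b \<and> weak_star_net X k G y \<longrightarrow>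
        (\<exists>w. (\<forall>a\<in>level A k. limitin (weak_star_topology X (Suc k)) (\<lambda>x. canon X k (l a x)) (w a) G) \<and>
             limitin (weak_star_topology X (Suc k)) w z F))"

definition ext_right ::
  "('k::topological_space, 'a) tower \<Rightarrow> ('k, 'x) tower \<Rightarrow> nat \<Rightarrow> ('x \<Rightarrow> 'a \<Rightarrow> 'x) \<Rightarrow> 'x \<Rightarrow> 'a \<Rightarrow> 'x" where
  "ext_right A X k r y b =
     (THE z. \<forall>F G. weak_star_net A k F b \<and> weak_star_net X k G y \<longrightarrow>
        (\<exists>w. (\<forall>x\<in>level X k. limitin (weak_star_topology X (Suc k)) (\<lambda>a. canon X k (r x a)) (w x) F) \<and>
             limitin (weak_star_topology X (Suc k)) w z G))"

text \<open>
  The product of \<open>level A n\<close> and its actions on \<open>level X n\<close>, for even \<open>n\<close>, from the product \<open>m\<close> and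
  the actions \<open>l\<close>, \<open>r\<close> at level 0. The values at odd levels are irrelevant.
\<close>

fun mult_at :: "('k, 'a) tower \<Rightarrow> ('a \<Rightarrow> 'a \<Rightarrow> 'a) \<Rightarrow> nat \<Rightarrow> 'a \<Rightarrow> 'a \<Rightarrow> 'a" where
  "mult_at A m 0 = m"
| "mult_at A m (Suc 0) = undefined"
| "mult_at A m (Suc (Suc n)) = arens A n (mult_at A m n)"

fun left_at ::
  "('k::topological_space, 'a) tower \<Rightarrow> ('k, 'x) tower \<Rightarrow> ('a \<Rightarrow> 'x \<Rightarrow> 'x) \<Rightarrow> nat \<Rightarrow> 'a \<Rightarrow> 'x \<Rightarrow> 'x" where
  "left_at A X l 0 = l"
| "left_at A X l (Suc 0) = undefined"
| "left_at A X l (Suc (Suc n)) = ext_left A X n (left_at A X l n)"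

fun right_at ::
  "('k::topological_space, 'a) tower \<Rightarrow> ('k, 'x) tower \<Rightarrow> ('x \<Rightarrow> 'a \<Rightarrow> 'x) \<Rightarrow> nat \<Rightarrow> 'x \<Rightarrow> 'a \<Rightarrow> 'x" where
  "right_at A X r 0 = r"
| "right_at A X r (Suc 0) = undefined"
| "right_at A X r (Suc (Suc n)) = ext_right A X n (right_at A X r n)"

end

theory Submission
  imports Defs
begin

text \<open>
  Write \<open>B\<close> for the algebra \<open>level A n\<close> and \<open>Y\<close> for the module \<open>level X n\<close>, so that \<open>D\<close> maps \<open>B\<close> to \<open>Y*\<close>;
  write \<open>D'\<close>, \<open>D''\<close> for the adjoints of \<open>D\<close>. The product of \<open>B**\<close> and both its actions on \<open>Y**\<close> are
  one construction applied to three bilinear maps: Arens's triple transpose \<open>arens_ext\<close>, which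
  extends a bounded bilinear map \<open>f\<close> to the second duals by
  \<open>\<langle>f(a,b), u\<rangle> = \<langle>a, x \<mapsto> \<langle>b, y \<mapsto> \<langle>u, f(x,y)\<rangle>\<rangle>\<rangle>\<close>. For the actions, which are given as iterated limits
  over all nets, this is the content of \<open>iterated_limit_iff\<close>. Such nets exist because a Banach
  space is weak* dense in its second dual, which is \<open>ex_weak_star_net\<close>.

  Now let \<open>a, b \<in> B**\<close> and \<open>y \<in> Y**\<close>. Expanding \<open>\<langle>D''(ab), y\<rangle> = \<langle>a, x \<mapsto> \<langle>b, c \<mapsto> \<langle>y, D(xc)\<rangle>\<rangle>\<rangle>\<close> by the rule for
  \<open>D\<close>, the summand \<open>D(x) S(c)\<close> yields exactly \<open>\<langle>D''(a) S''(b), y\<rangle>\<close>, by unwinding definitions. The other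
  summand yields \<open>\<langle>a, \<Psi>\<rangle>\<close>, where \<open>\<Psi> \<in> B*\<close> takes at \<open>x\<close> the value
  \<open>\<langle>b, c \<mapsto> \<langle>y, T(x) D(c)\<rangle>\<rangle> = \<langle>D''(b), y T''(x)\<rangle>\<close>. The wanted value is \<open>\<langle>T''(a) D''(b), y\<rangle> = \<langle>D''(b), y T''(a)\<rangle>\<close>. Thus
  two functionals of \<open>a\<close> are to be compared that agree on \<open>B\<close>. The first is weak* continuous since
  \<open>\<Psi>\<close> lies in \<open>B*\<close>, and the second is so by the hypothesis on \<open>T\<close>, applied to the weak topology of
  \<open>Y**\<close>, whose functionals include \<open>D''(b)\<close>. Hence they agree on \<open>B**\<close>. This is carried out
  in \<open>adj2_product_rule\<close>.
\<close>

section \<open>Bounded linear and bilinear maps on subspaces\<close>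

definition normed_subspace ::
  "('k::real_normed_field \<Rightarrow> 'v::real_normed_vector \<Rightarrow> 'v) \<Rightarrow> 'v set \<Rightarrow> bool" where
  "normed_subspace s E \<longleftrightarrow>
     vector_space s \<and> (\<forall>c x. norm (s c x) = norm c * norm x) \<and> module.subspace s E"

lemma normed_subspaceD:
  assumes "normed_subspace s E"
  shows "vector_space s" "module s" "norm (s c x) = norm c * norm x" "0 \<in> E"
    "x \<in> E \<Longrightarrow> y \<in> E \<Longrightarrow> x + y \<in> E" "x \<in> E \<Longrightarrow> y \<in> E \<Longrightarrow> x - y \<in> E"
    "x \<in> E \<Longrightarrow> s c x \<in> E"
proof -
  show V: "vector_space s" using assms by (simp add: normed_subspace_def)
  then interpret vector_space s .
  have S: "subspace E" using assms by (simp add: normed_subspace_def)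
  show "module s" by (rule module_axioms)
  show "norm (s c x) = norm c * norm x" using assms by (simp add: normed_subspace_def)
  show "0 \<in> E" using S by (rule subspace_0)
  show "x \<in> E \<Longrightarrow> y \<in> E \<Longrightarrow> x + y \<in> E" using S by (rule subspace_add)
  show "x \<in> E \<Longrightarrow> y \<in> E \<Longrightarrow> x - y \<in> E" using S by (rule subspace_diff)
  show "x \<in> E \<Longrightarrow> s c x \<in> E" using S by (rule subspace_scale)
qed

lemma linear_map_onD:
  assumes "linear_map_on s t E F f"
  shows "x \<in> E \<Longrightarrow> f x \<in> F" "x \<in> E \<Longrightarrow> y \<in> E \<Longrightarrow> f (x + y) = f x + f y"
    "x \<in> E \<Longrightarrow> f (s c x) = t c (f x)"
  using assms by (auto simp: linear_map_on_def)

lemma linear_map_on_zero_diff: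
  assumes f: "linear_map_on s t E F f" and E: "normed_subspace s E"
  shows "f 0 = 0" "x \<in> E \<Longrightarrow> y \<in> E \<Longrightarrow> f (x - y) = f x - f y"
proof -
  note D = normed_subspaceD[OF E]
  have "f (0 + 0) = f 0 + f 0" using D(4) linear_map_onD(2)[OF f] by blast
  then show "f 0 = 0" by simp
  assume xy: "x \<in> E" "y \<in> E"
  have "f ((x - y) + y) = f (x - y) + f y" using D(6) xy linear_map_onD(2)[OF f] by blast
  then show "f (x - y) = f x - f y" by simp
qed

lemma bounded_linear_map_onE:
  assumes "bounded_linear_map_on s t E F f"
  obtains K where "K \<ge> 0" "\<And>x. x \<in> E \<Longrightarrow> norm (f x) \<le> K * norm x"
proof -
  obtain K where K: "\<And>x. x \<in> E \<Longrightarrow> norm (f x) \<le> K * norm x"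
    using assms by (auto simp: bounded_linear_map_on_def)
  have "norm (f x) \<le> max K 0 * norm x" if "x \<in> E" for x
    by (rule order_trans[OF K[OF that]]) (simp add: mult_right_mono)
  then show ?thesis using that[of "max K 0"] by simp
qed

lemma bounded_linear_map_on_comp:
  assumes f: "bounded_linear_map_on s t E F f" and g: "bounded_linear_map_on t u F G g"
  shows "bounded_linear_map_on s u E G (\<lambda>x. g (f x))"
proof -
  obtain K where K: "K \<ge> 0" "\<And>x. x \<in> E \<Longrightarrow> norm (f x) \<le> K * norm x"
    using bounded_linear_map_onE[OF f] by blast
  obtain L where L: "L \<ge> 0" "\<And>x. x \<in> F \<Longrightarrow> norm (g x) \<le> L * norm x"
    using bounded_linear_map_onE[OF g] by blast
  have lf: "linear_map_on s t E F f" and lg: "linear_map_on t u F G g"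
    using f g by (auto simp: bounded_linear_map_on_def)
  have "norm (g (f x)) \<le> (L * K) * norm x" if "x \<in> E" for x
  proof -
    have "norm (g (f x)) \<le> L * norm (f x)" using L(2) linear_map_onD(1)[OF lf that] by blast
    also have "\<dots> \<le> L * (K * norm x)" using K(2)[OF that] L(1) by (rule mult_left_mono)
    finally show ?thesis by (simp add: mult.assoc)
  qed
  moreover have "linear_map_on s u E G (\<lambda>x. g (f x))"
    using lf lg by (auto simp: linear_map_on_def)
  ultimately show ?thesis by (auto simp: bounded_linear_map_on_def)
qed

lemma bounded_linear_map_on_continuous:
  assumes f: "bounded_linear_map_on s t E F f" and E: "normed_subspace s E"
  shows "continuous_on E f"
proof -
  obtain K where K: "K \<ge> 0" "\<And>x. x \<in> E \<Longrightarrow> norm (f x) \<le> K * norm x"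
    using bounded_linear_map_onE[OF f] by blast
  have lf: "linear_map_on s t E F f" using f by (auto simp: bounded_linear_map_on_def)
  have "K-lipschitz_on E f"
  proof (rule lipschitz_onI[OF _ K(1)])
    fix x y assume xy: "x \<in> E" "y \<in> E"
    show "dist (f x) (f y) \<le> K * dist x y"
      using K(2)[OF normed_subspaceD(6)[OF E xy]] linear_map_on_zero_diff(2)[OF lf E xy]
      by (simp add: dist_norm)
  qed
  then show ?thesis by (rule lipschitz_on_continuous_on)
qed

text \<open>
  The scaling of a vector to a norm below the modulus of continuity uses the multiplication \<open>s\<close>
  by real elements of the scalar field, for which \<open>norm (s c x) = norm c * norm x\<close>.
\<close>

lemma continuous_linear_map_on_bounded:
  assumes f: "linear_map_on s t E F f" and c: "continuous_on E f"
    and E: "normed_subspace s E" and F: "normed_subspace t F"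
  shows "bounded_linear_map_on s t E F f"
proof -
  note D = normed_subspaceD[OF E]
  obtain d where d: "d > 0" "\<And>x. x \<in> E \<Longrightarrow> dist x 0 < d \<Longrightarrow> dist (f x) (f 0) < 1"
    using c D(4) unfolding continuous_on_iff by (metis zero_less_one)
  have "norm (f x) \<le> (2 / d) * norm x" if x: "x \<in> E" for x
  proof (cases "x = 0")
    case True
    then show ?thesis using linear_map_on_zero_diff(1)[OF f E] by simp
  next
    case False
    define e where "e = d / (2 * norm x)"
    have e: "e > 0" using d(1) False by (simp add: e_def)
    have "norm (s (of_real e) x) = d / 2"
      unfolding D(3) norm_of_real using False d(1) by (simp add: e_def)
    then have "norm (f (s (of_real e) x)) < 1"
      using d(1) d(2)[OF D(7)[OF x], of "of_real e"] linear_map_on_zero_diff(1)[OF f E] by simp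
    then have "e * norm (f x) < 1"
      using e linear_map_onD(3)[OF f x] normed_subspaceD(3)[OF F] by simp
    then show ?thesis using False d(1) by (simp add: e_def field_simps)
  qed
  then show ?thesis using f unfolding bounded_linear_map_on_def by blast
qed

lemma bounded_bilinear_map_onD:
  assumes "bounded_bilinear_map_on s t u E F G f"
  shows "x \<in> E \<Longrightarrow> bounded_linear_map_on t u F G (f x)"
    "y \<in> F \<Longrightarrow> bounded_linear_map_on s u E G (\<lambda>x. f x y)"
    "x \<in> E \<Longrightarrow> y \<in> F \<Longrightarrow> f x y \<in> G"
proof -
  obtain K where K: "\<And>x y. x \<in> E \<Longrightarrow> y \<in> F \<Longrightarrow> norm (f x y) \<le> K * norm x * norm y"
    using assms unfolding bounded_bilinear_map_on_def by blast
  show "x \<in> E \<Longrightarrow> bounded_linear_map_on t u F G (f x)"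
    using K assms unfolding bounded_bilinear_map_on_def bounded_linear_map_on_def by blast
  show "bounded_linear_map_on s u E G (\<lambda>x. f x y)" if "y \<in> F"
    using assms that K[OF _ that]
    unfolding bounded_bilinear_map_on_def bounded_linear_map_on_def
    by (auto intro!: exI[of _ "K * norm y"] simp: mult_ac)
  show "x \<in> E \<Longrightarrow> y \<in> F \<Longrightarrow> f x y \<in> G"
    using assms by (auto simp: bounded_bilinear_map_on_def linear_map_on_def)
qed

lemma bounded_bilinear_map_on_boundE:
  assumes "bounded_bilinear_map_on s t u E F G f"
  obtains K where "K \<ge> 0" "\<And>x y. x \<in> E \<Longrightarrow> y \<in> F \<Longrightarrow> norm (f x y) \<le> K * norm x * norm y"
proof -
  obtain K where K: "\<And>x y. x \<in> E \<Longrightarrow> y \<in> F \<Longrightarrow> norm (f x y) \<le> K * norm x * norm y"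
    using assms unfolding bounded_bilinear_map_on_def by blast
  have "norm (f x y) \<le> max K 0 * norm x * norm y" if "x \<in> E" "y \<in> F" for x y
    by (rule order_trans[OF K[OF that]]) (intro mult_right_mono; simp)
  then show ?thesis using that[of "max K 0"] by simp
qed


section \<open>Duality\<close>

definition dual_at :: "('k::real_normed_field, 'v::real_normed_vector) tower \<Rightarrow> nat \<Rightarrow> bool" where
  "dual_at A k \<longleftrightarrow> normed_subspace (scal A) (level A k) \<and>
     is_dual (scal A) (level A k) (level A (Suc k)) (pairing A k)"

abbreviation functional ::
  "('k::real_normed_field, 'v::real_normed_vector) tower \<Rightarrow> nat \<Rightarrow> ('v \<Rightarrow> 'k) \<Rightarrow> bool" where
  "functional A k f \<equiv> bounded_linear_map_on (scal A) (*) (level A k) UNIV f"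

lemma dual_at_subspaces:
  assumes "dual_at A k"
  shows "normed_subspace (scal A) (level A k)" "normed_subspace (scal A) (level A (Suc k))"
  using assms by (auto simp: dual_at_def is_dual_def normed_subspace_def)

lemma dual_tower_dual_at:
  assumes "dual_tower N A" "k < N"
  shows "dual_at A k"
  using assms(2)
proof (induction k)
  case 0
  then show ?case using assms(1)
    by (auto simp: dual_at_def dual_tower_def banach_space_def normed_subspace_def)
next
  case (Suc k)
  then have "dual_at A k" by simp
  then show ?case using dual_at_subspaces(2)[of A k] assms(1) Suc.prems
    by (auto simp: dual_at_def dual_tower_def)
qed

lemma pairing_functional:
  assumes "dual_at A k" "u \<in> level A (Suc k)"
  shows "functional A k (pairing A k u)"
  using assms by (auto simp: dual_at_def is_dual_def)

lemma pairing_linear_left: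
  assumes "dual_at A k" "x \<in> level A k"
  shows "linear_map_on (scal A) (*) (level A (Suc k)) UNIV (\<lambda>u. pairing A k u x)"
  using assms by (auto simp: dual_at_def is_dual_def)

lemma pairing_simps:
  assumes "dual_at A k"
  shows "u \<in> level A (Suc k) \<Longrightarrow> x \<in> level A k \<Longrightarrow> y \<in> level A k \<Longrightarrow>
      pairing A k u (x + y) = pairing A k u x + pairing A k u y"
    "u \<in> level A (Suc k) \<Longrightarrow> x \<in> level A k \<Longrightarrow> y \<in> level A k \<Longrightarrow>
      pairing A k u (x - y) = pairing A k u x - pairing A k u y"
    "u \<in> level A (Suc k) \<Longrightarrow> x \<in> level A k \<Longrightarrow>
      pairing A k u (scal A c x) = c * pairing A k u x"
    "u \<in> level A (Suc k) \<Longrightarrow> v \<in> level A (Suc k) \<Longrightarrow> x \<in> level A k \<Longrightarrow>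
      pairing A k (u + v) x = pairing A k u x + pairing A k v x"
    "u \<in> level A (Suc k) \<Longrightarrow> v \<in> level A (Suc k) \<Longrightarrow> x \<in> level A k \<Longrightarrow>
      pairing A k (u - v) x = pairing A k u x - pairing A k v x"
    "u \<in> level A (Suc k) \<Longrightarrow> x \<in> level A k \<Longrightarrow>
      pairing A k (scal A c u) x = c * pairing A k u x"
    "u \<in> level A (Suc k) \<Longrightarrow> pairing A k u 0 = 0"
    "x \<in> level A k \<Longrightarrow> pairing A k 0 x = 0"
  using pairing_functional[OF assms] pairing_linear_left[OF assms]
    linear_map_on_zero_diff[OF pairing_linear_left[OF assms] dual_at_subspaces(2)[OF assms]]
    linear_map_on_zero_diff[OF _ dual_at_subspaces(1)[OF assms], of "(*)" UNIV "pairing A k u"]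
  by (auto simp: bounded_linear_map_on_def linear_map_on_def)

lemma dual_norm_le:
  assumes A: "dual_at A k" and u: "u \<in> level A (Suc k)"
    and K: "K \<ge> 0" "\<And>x. x \<in> level A k \<Longrightarrow> norm (pairing A k u x) \<le> K * norm x"
  shows "norm u \<le> K"
proof -
  have "norm u = (SUP x\<in>{x\<in>level A k. norm x \<le> 1}. norm (pairing A k u x))"
    using A u by (auto simp: dual_at_def is_dual_def)
  also have "\<dots> \<le> K"
  proof (rule cSUP_least)
    show "{x \<in> level A k. norm x \<le> 1} \<noteq> {}"
      using normed_subspaceD(4)[OF dual_at_subspaces(1)[OF A]] by (auto intro!: exI[of _ 0])
    fix x assume "x \<in> {x \<in> level A k. norm x \<le> 1}"
    then show "norm (pairing A k u x) \<le> K"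
      using K(2)[of x] mult_left_mono[of "norm x" 1 K] K(1) by auto
  qed
  finally show ?thesis .
qed

lemma pairing_bound:
  assumes A: "dual_at A k" and u: "u \<in> level A (Suc k)" and x: "x \<in> level A k"
  shows "norm (pairing A k u x) \<le> norm u * norm x"
proof (cases "x = 0")
  case True
  then show ?thesis using pairing_simps(7)[OF A u] by simp
next
  case False
  note D = normed_subspaceD[OF dual_at_subspaces(1)[OF A]]
  obtain K where K: "K \<ge> 0" "\<And>x. x \<in> level A k \<Longrightarrow> norm (pairing A k u x) \<le> K * norm x"
    using bounded_linear_map_onE[OF pairing_functional[OF A u]] by blast
  define y where "y = scal A (of_real (1 / norm x)) x"
  have y: "y \<in> level A k" using D(7)[OF x] by (simp add: y_def)
  have ny: "norm y = 1" unfolding y_def D(3) norm_of_real using False by simp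
  have "norm (pairing A k u y) \<le> (SUP x\<in>{x\<in>level A k. norm x \<le> 1}. norm (pairing A k u x))"
  proof (rule cSUP_upper)
    show "y \<in> {x \<in> level A k. norm x \<le> 1}" using y ny by simp
    have "norm (pairing A k u x) \<le> K" if "x \<in> level A k" "norm x \<le> 1" for x
      using K(2)[OF that(1)] mult_left_mono[OF that(2) K(1)] by simp
    then show "bdd_above ((\<lambda>x. norm (pairing A k u x)) ` {x \<in> level A k. norm x \<le> 1})"
      by (intro bdd_aboveI2[of _ _ K]) auto
  qed
  also have "\<dots> = norm u" using A u by (auto simp: dual_at_def is_dual_def)
  finally have "norm (pairing A k u y) \<le> norm u" .
  moreover have "norm (pairing A k u y) = norm (pairing A k u x) / norm x"
    unfolding y_def pairing_simps(3)[OF A u x] by (simp add: norm_mult norm_divide)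
  ultimately show ?thesis using False by (simp add: field_simps)
qed

lemma dual_eqI:
  assumes A: "dual_at A k" and u: "u \<in> level A (Suc k)" and v: "v \<in> level A (Suc k)"
    and eq: "\<And>x. x \<in> level A k \<Longrightarrow> pairing A k u x = pairing A k v x"
  shows "u = v"
proof -
  have "u - v \<in> level A (Suc k)" using normed_subspaceD(6)[OF dual_at_subspaces(2)[OF A] u v] .
  then have "norm (u - v) \<le> 0"
    by (rule dual_norm_le[OF A]) (auto simp: pairing_simps(5)[OF A u v] eq)
  then show ?thesis by simp
qed

lemma rep:
  assumes A: "dual_at A k" and f: "functional A k f"
  shows "rep A k f \<in> level A (Suc k)" "x \<in> level A k \<Longrightarrow> pairing A k (rep A k f) x = f x"
proof -
  obtain u where u: "u \<in> level A (Suc k)" "\<forall>x\<in>level A k. pairing A k u x = f x"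
    using A f by (auto simp: dual_at_def is_dual_def)
  have "rep A k f \<in> level A (Suc k) \<and> (\<forall>x\<in>level A k. pairing A k (rep A k f) x = f x)"
    unfolding rep_def
  proof (rule theI)
    show "u \<in> level A (Suc k) \<and> (\<forall>x\<in>level A k. pairing A k u x = f x)" using u by blast
  next
    fix v assume "v \<in> level A (Suc k) \<and> (\<forall>x\<in>level A k. pairing A k v x = f x)"
    then show "v = u" using u by (intro dual_eqI[OF A]) auto
  qed
  then show "rep A k f \<in> level A (Suc k)" "x \<in> level A k \<Longrightarrow> pairing A k (rep A k f) x = f x"
    by auto
qed

lemma evaluation_functional:
  assumes A: "dual_at A k" and x: "x \<in> level A k"
  shows "functional A (Suc k) (\<lambda>u. pairing A k u x)"
  unfolding bounded_linear_map_on_def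
proof
  show "linear_map_on (scal A) (*) (level A (Suc k)) UNIV (\<lambda>u. pairing A k u x)"
    by (rule pairing_linear_left[OF A x])
  show "\<exists>K. \<forall>u\<in>level A (Suc k). norm (pairing A k u x) \<le> K * norm u"
    using pairing_bound[OF A _ x] by (intro exI[of _ "norm x"]) (simp add: mult.commute)
qed

lemma canon:
  assumes "dual_at A k" "dual_at A (Suc k)" "x \<in> level A k"
  shows "canon A k x \<in> level A (Suc (Suc k))"
    "u \<in> level A (Suc k) \<Longrightarrow> pairing A (Suc k) (canon A k x) u = pairing A k u x"
  using rep[OF assms(2) evaluation_functional[OF assms(1,3)]] by (auto simp: canon_def)

lemma adj:
  assumes A: "dual_at A i" and B: "dual_at B j"
    and T: "bounded_linear_map_on (scal A) (scal B) (level A i) (level B j) T"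
  shows "bounded_linear_map_on (scal B) (scal A) (level B (Suc j)) (level A (Suc i)) (adj A i B j T)"
    and "v \<in> level B (Suc j) \<Longrightarrow> x \<in> level A i \<Longrightarrow>
      pairing A i (adj A i B j T v) x = pairing B j v (T x)"
proof -
  note R = rep[OF A bounded_linear_map_on_comp[OF T pairing_functional[OF B]], folded adj_def]
  note SA = normed_subspaceD[OF dual_at_subspaces(2)[OF A]]
  note SB = normed_subspaceD[OF dual_at_subspaces(2)[OF B]]
  have TB: "x \<in> level A i \<Longrightarrow> T x \<in> level B j" for x
    using T by (auto simp: bounded_linear_map_on_def linear_map_on_def)
  obtain K where K: "K \<ge> 0" "\<And>x. x \<in> level A i \<Longrightarrow> norm (T x) \<le> K * norm x"
    using bounded_linear_map_onE[OF T] by blast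
  have "norm (adj A i B j T v) \<le> K * norm v" if v: "v \<in> level B (Suc j)" for v
  proof (rule dual_norm_le[OF A R(1)[OF v]])
    show "K * norm v \<ge> 0" using K(1) by simp
    fix x assume x: "x \<in> level A i"
    have "norm (pairing B j v (T x)) \<le> norm v * norm (T x)"
      by (rule pairing_bound[OF B v TB[OF x]])
    also have "\<dots> \<le> norm v * (K * norm x)" by (intro mult_left_mono K(2) x) simp
    finally show "norm (pairing A i (adj A i B j T v) x) \<le> K * norm v * norm x"
      by (simp add: R(2)[OF v x] mult_ac)
  qed
  moreover have "linear_map_on (scal B) (scal A) (level B (Suc j)) (level A (Suc i)) (adj A i B j T)"
    unfolding linear_map_on_def
    by (auto intro!: dual_eqI[OF A] simp: R SA SB TB pairing_simps[OF A] pairing_simps[OF B])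
  ultimately show "bounded_linear_map_on (scal B) (scal A) (level B (Suc j)) (level A (Suc i)) (adj A i B j T)"
    by (auto simp: bounded_linear_map_on_def)
  show "v \<in> level B (Suc j) \<Longrightarrow> x \<in> level A i \<Longrightarrow>
      pairing A i (adj A i B j T v) x = pairing B j v (T x)" by (rule R(2))
qed

lemma adj2:
  assumes A: "dual_at A i" "dual_at A (Suc i)" and B: "dual_at B j" "dual_at B (Suc j)"
    and T: "bounded_linear_map_on (scal A) (scal B) (level A i) (level B j) T"
  shows "bounded_linear_map_on (scal A) (scal B) (level A (i + 2)) (level B (j + 2)) (adj2 A i B j T)"
    and "a \<in> level A (i + 2) \<Longrightarrow> v \<in> level B (Suc j) \<Longrightarrow>
      pairing B (Suc j) (adj2 A i B j T a) v = pairing A (Suc i) a (adj A i B j T v)"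
  using adj[OF B(2) A(2) adj(1)[OF A(1) B(1) T]] by (auto simp: adj2_def)


section \<open>Transposes of bilinear maps and the Arens extension\<close>

text \<open>
  The transpose of \<open>f : E \<times> F \<rightarrow> G\<close>, as a bilinear map \<open>G* \<times> E \<rightarrow> F*\<close>. This shape allows iteration:
  transposing again gives \<open>F** \<times> G* \<rightarrow> E*\<close>, and a third time \<open>E** \<times> F** \<rightarrow> G**\<close>.
\<close>

definition tadj ::
  "('k, 'b) tower \<Rightarrow> nat \<Rightarrow> ('k, 'c) tower \<Rightarrow> nat \<Rightarrow> ('a \<Rightarrow> 'b \<Rightarrow> 'c) \<Rightarrow> 'c \<Rightarrow> 'a \<Rightarrow> 'b" where
  "tadj B j C k f u x = rep B j (\<lambda>y. pairing C k u (f x y))"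

lemma tadj:
  assumes B: "dual_at B j" and C: "dual_at C k"
    and f: "bounded_bilinear_map_on s (scal B) (scal C) E (level B j) (level C k) f"
    and E: "normed_subspace s E"
  shows "bounded_bilinear_map_on (scal C) s (scal B) (level C (Suc k)) E (level B (Suc j)) (tadj B j C k f)"
    and "u \<in> level C (Suc k) \<Longrightarrow> x \<in> E \<Longrightarrow> y \<in> level B j \<Longrightarrow>
      pairing B j (tadj B j C k f u x) y = pairing C k u (f x y)"
proof -
  note R = rep[OF B bounded_linear_map_on_comp[OF bounded_bilinear_map_onD(1)[OF f]
          pairing_functional[OF C]], folded tadj_def]
  note SB = normed_subspaceD[OF dual_at_subspaces(2)[OF B]]
  note SC = normed_subspaceD[OF dual_at_subspaces(2)[OF C]]
  note fG = bounded_bilinear_map_onD(3)[OF f]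
  have fx: "x \<in> E \<Longrightarrow> x' \<in> E \<Longrightarrow> y \<in> level B j \<Longrightarrow> f (x + x') y = f x y + f x' y"
    "x \<in> E \<Longrightarrow> y \<in> level B j \<Longrightarrow> f (s c x) y = scal C c (f x y)" for x x' y c
    using f by (auto simp: bounded_bilinear_map_on_def linear_map_on_def)
  obtain K where K: "K \<ge> 0" "\<And>x y. x \<in> E \<Longrightarrow> y \<in> level B j \<Longrightarrow> norm (f x y) \<le> K * norm x * norm y"
    using bounded_bilinear_map_on_boundE[OF f] by blast
  have bound: "norm (tadj B j C k f u x) \<le> K * norm u * norm x"
    if u: "u \<in> level C (Suc k)" and x: "x \<in> E" for u x
  proof (rule dual_norm_le[OF B R(1)[OF x u]])
    show "K * norm u * norm x \<ge> 0" using K(1) by simp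
    fix y assume y: "y \<in> level B j"
    have "norm (pairing C k u (f x y)) \<le> norm u * norm (f x y)"
      by (rule pairing_bound[OF C u fG[OF x y]])
    also have "\<dots> \<le> norm u * (K * norm x * norm y)" by (intro mult_left_mono K(2) x y) simp
    finally show "norm (pairing B j (tadj B j C k f u x) y) \<le> K * norm u * norm x * norm y"
      by (simp add: R(2)[OF x u y] mult_ac)
  qed
  have "linear_map_on s (scal B) E (level B (Suc j)) (tadj B j C k f u)"
    if u: "u \<in> level C (Suc k)" for u
    unfolding linear_map_on_def using u
    by (auto intro!: dual_eqI[OF B]
        simp: R SB SC fG fx normed_subspaceD[OF E] pairing_simps[OF B] pairing_simps[OF C])
  moreover have "linear_map_on (scal C) (scal B) (level C (Suc k)) (level B (Suc j))
      (\<lambda>u. tadj B j C k f u x)" if x: "x \<in> E" for x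
    unfolding linear_map_on_def using x
    by (auto intro!: dual_eqI[OF B]
        simp: R SB SC fG pairing_simps[OF B] pairing_simps[OF C])
  ultimately show "bounded_bilinear_map_on (scal C) s (scal B) (level C (Suc k)) E (level B (Suc j)) (tadj B j C k f)"
    using bound unfolding bounded_bilinear_map_on_def by blast
  show "u \<in> level C (Suc k) \<Longrightarrow> x \<in> E \<Longrightarrow> y \<in> level B j \<Longrightarrow>
      pairing B j (tadj B j C k f u x) y = pairing C k u (f x y)" using R(2) by blast
qed

definition arens_ext ::
  "('k, 'a) tower \<Rightarrow> ('k, 'b) tower \<Rightarrow> ('k, 'c) tower \<Rightarrow> nat \<Rightarrow> ('a \<Rightarrow> 'b \<Rightarrow> 'c) \<Rightarrow> 'a \<Rightarrow> 'b \<Rightarrow> 'c" where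
  "arens_ext A B C k f =
     tadj C (Suc k) A (Suc k) (tadj A k B (Suc k) (tadj B k C k f))"

text \<open>
  The auxiliary products in the definition of the first Arens product are the successive
  transposes of the multiplication.
\<close>

lemma arens_eq_arens_ext: "arens A k m = arens_ext A A A k m"
  unfolding fun_eq_iff arens_def arens_left_def dual_right_def arens_ext_def tadj_def by simp

lemma dual_right_eq_tadj: "dual_right X k l = tadj X k X k l"
  unfolding fun_eq_iff dual_right_def tadj_def by simp

lemma dual_left_eq_adj: "dual_left X k r b = adj X k X k (\<lambda>x. r x b)"
  unfolding fun_eq_iff dual_left_def adj_def by simp

lemma arens_ext:
  assumes A: "dual_at A k" "dual_at A (Suc k)"
    and B: "dual_at B k" "dual_at B (Suc k)"
    and C: "dual_at C k" "dual_at C (Suc k)"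
    and f: "bounded_bilinear_map_on (scal A) (scal B) (scal C) (level A k) (level B k) (level C k) f"
  shows "bounded_bilinear_map_on (scal A) (scal B) (scal C)
      (level A (k + 2)) (level B (k + 2)) (level C (k + 2)) (arens_ext A B C k f)"
    and "a \<in> level A (k + 2) \<Longrightarrow> b \<in> level B (k + 2) \<Longrightarrow> u \<in> level C (Suc k) \<Longrightarrow>
      pairing C (Suc k) (arens_ext A B C k f a b) u =
      pairing A (Suc k) a (tadj A k B (Suc k) (tadj B k C k f) b u)"
    and "b \<in> level B (k + 2) \<Longrightarrow> u \<in> level C (Suc k) \<Longrightarrow> x \<in> level A k \<Longrightarrow>
      pairing A k (tadj A k B (Suc k) (tadj B k C k f) b u) x =
      pairing B (Suc k) b (tadj B k C k f u x)"
    and "b \<in> level B (k + 2) \<Longrightarrow> u \<in> level C (Suc k) \<Longrightarrow>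
      tadj A k B (Suc k) (tadj B k C k f) b u \<in> level A (Suc k)"
proof -
  note t1 = tadj[OF B(1) C(1) f dual_at_subspaces(1)[OF A(1)]]
  note t2 = tadj[OF A(1) B(2) t1(1) dual_at_subspaces(2)[OF C(1)]]
  note t3 = tadj[OF C(2) A(2) t2(1) dual_at_subspaces(2)[OF B(2)], folded arens_ext_def]
  show "bounded_bilinear_map_on (scal A) (scal B) (scal C)
      (level A (k + 2)) (level B (k + 2)) (level C (k + 2)) (arens_ext A B C k f)"
    using t3(1) by simp
  show "a \<in> level A (k + 2) \<Longrightarrow> b \<in> level B (k + 2) \<Longrightarrow> u \<in> level C (Suc k) \<Longrightarrow>
      pairing C (Suc k) (arens_ext A B C k f a b) u =
      pairing A (Suc k) a (tadj A k B (Suc k) (tadj B k C k f) b u)"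
    using t3(2) by simp
  show "b \<in> level B (k + 2) \<Longrightarrow> u \<in> level C (Suc k) \<Longrightarrow> x \<in> level A k \<Longrightarrow>
      pairing A k (tadj A k B (Suc k) (tadj B k C k f) b u) x =
      pairing B (Suc k) b (tadj B k C k f u x)"
    using t2(2) by simp
  show "b \<in> level B (k + 2) \<Longrightarrow> u \<in> level C (Suc k) \<Longrightarrow>
      tadj A k B (Suc k) (tadj B k C k f) b u \<in> level A (Suc k)"
    using bounded_bilinear_map_onD(3)[OF t2(1)] by simp
qed


section \<open>Weak* convergence\<close>

text \<open>
  The sets \<open>{x \<in> E. f x \<in> U}\<close> form only a subbasis; that it suffices to test convergence on them
  is an induction over the generation of the topology.
\<close>

lemma limitin_initial_topology:
  assumes "\<Phi> \<noteq> {}"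
  shows "limitin (initial_topology E \<Phi>) g z F \<longleftrightarrow>
    z \<in> E \<and> (\<forall>\<^sub>F i in F. g i \<in> E) \<and> (\<forall>f\<in>\<Phi>. ((\<lambda>i. f (g i)) \<longlongrightarrow> f z) F)"
proof
  let ?S = "{{x\<in>E. f x \<in> U} |f U. f \<in> \<Phi> \<and> open U}"
  have op: "openin (initial_topology E \<Phi>) {x\<in>E. f x \<in> U}" if "f \<in> \<Phi>" "open U" for f U
    unfolding initial_topology_def by (rule topology_generated_by_Basis) (use that in blast)
  obtain f0 where f0: "f0 \<in> \<Phi>" using assms by blast
  have top: "topspace (initial_topology E \<Phi>) = E"
  proof
    show "topspace (initial_topology E \<Phi>) \<subseteq> E"
      unfolding initial_topology_def topology_generated_by_topspace by blast
    show "E \<subseteq> topspace (initial_topology E \<Phi>)"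
      using openin_subset[OF op[OF f0 open_UNIV]] by simp
  qed
  {
    assume L: "limitin (initial_topology E \<Phi>) g z F"
    have z: "z \<in> E" using L top by (simp add: limitin_def)
    have ev: "\<forall>\<^sub>F i in F. g i \<in> E \<and> f (g i) \<in> U" if "f \<in> \<Phi>" "open U" "f z \<in> U" for f U
      using L op[OF that(1,2)] z that(3) unfolding limitin_def by fastforce
    show "z \<in> E \<and> (\<forall>\<^sub>F i in F. g i \<in> E) \<and> (\<forall>f\<in>\<Phi>. ((\<lambda>i. f (g i)) \<longlongrightarrow> f z) F)"
    proof (intro conjI ballI topological_tendstoI)
      show "z \<in> E" by (rule z)
      show "\<forall>\<^sub>F i in F. g i \<in> E" using ev[OF f0 open_UNIV] by simp
      fix f U assume "f \<in> \<Phi>" "open U" "f z \<in> U"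
      then show "\<forall>\<^sub>F i in F. f (g i) \<in> U" using ev[of f U] by (auto elim: eventually_mono)
    qed
  next
    assume R: "z \<in> E \<and> (\<forall>\<^sub>F i in F. g i \<in> E) \<and> (\<forall>f\<in>\<Phi>. ((\<lambda>i. f (g i)) \<longlongrightarrow> f z) F)"
    have "\<forall>\<^sub>F i in F. g i \<in> V" if "generate_topology_on ?S V" "z \<in> V" for V
      using that
    proof (induction rule: generate_topology_on.induct)
      case Empty
      then show ?case by simp
    next
      case (Int a b)
      then show ?case by (auto simp: eventually_conj_iff)
    next
      case (UN K)
      then obtain k where "k \<in> K" "z \<in> k" by blast
      then have "\<forall>\<^sub>F i in F. g i \<in> k" using UN.IH by blast
      then show ?case by (rule eventually_mono) (use \<open>k \<in> K\<close> in blast)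
    next
      case (Basis s)
      then obtain f U where fU: "s = {x\<in>E. f x \<in> U}" "f \<in> \<Phi>" "open U" "f z \<in> U" by blast
      have "((\<lambda>i. f (g i)) \<longlongrightarrow> f z) F" using R fU(2) by blast
      then have "\<forall>\<^sub>F i in F. f (g i) \<in> U" using fU(3,4) by (rule topological_tendstoD)
      with R show ?case unfolding fU(1) by (auto simp: eventually_conj_iff)
    qed
    then show "limitin (initial_topology E \<Phi>) g z F"
      unfolding limitin_def top using R
      by (auto simp: initial_topology_def openin_topology_generated_by_iff)
  }
qed

lemma limitin_weak_star_topology:
  assumes "dual_at A k"
  shows "limitin (weak_star_topology A k) g z F \<longleftrightarrow>
    z \<in> level A (Suc k) \<and> (\<forall>\<^sub>F i in F. g i \<in> level A (Suc k)) \<and>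
    (\<forall>x\<in>level A k. ((\<lambda>i. pairing A k (g i) x) \<longlongrightarrow> pairing A k z x) F)"
proof -
  have "level A k \<noteq> {}" using normed_subspaceD(4)[OF dual_at_subspaces(1)[OF assms]] by blast
  then show ?thesis unfolding weak_star_topology_def by (subst limitin_initial_topology) auto
qed

lemma limitin_weak_topology:
  assumes "dual_at A k"
  shows "limitin (weak_topology A k) g z F \<longleftrightarrow>
    z \<in> level A k \<and> (\<forall>\<^sub>F i in F. g i \<in> level A k) \<and>
    (\<forall>u\<in>level A (Suc k). ((\<lambda>i. pairing A k u (g i)) \<longlongrightarrow> pairing A k u z) F)"
proof -
  have "level A (Suc k) \<noteq> {}" using normed_subspaceD(4)[OF dual_at_subspaces(2)[OF assms]] by blast
  then show ?thesis unfolding weak_topology_def by (subst limitin_initial_topology) auto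
qed

lemma weak_star_netD:
  assumes A: "dual_at A k" "dual_at A (Suc k)" and F: "weak_star_net A k F a"
  shows "F \<noteq> bot" "\<forall>\<^sub>F x in F. x \<in> level A k" "a \<in> level A (k + 2)"
    "u \<in> level A (Suc k) \<Longrightarrow> (pairing A k u \<longlongrightarrow> pairing A (Suc k) a u) F"
proof -
  show "F \<noteq> bot" and E: "\<forall>\<^sub>F x in F. x \<in> level A k"
    using F by (auto simp: weak_star_net_def)
  have L: "limitin (weak_star_topology A (Suc k)) (canon A k) a F"
    using F by (simp add: weak_star_net_def)
  then show "a \<in> level A (k + 2)" by (simp add: limitin_weak_star_topology[OF A(2)])
  assume u: "u \<in> level A (Suc k)"
  have "((\<lambda>x. pairing A (Suc k) (canon A k x) u) \<longlongrightarrow> pairing A (Suc k) a u) F"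
    using L u by (simp add: limitin_weak_star_topology[OF A(2)])
  then show "(pairing A k u \<longlongrightarrow> pairing A (Suc k) a u) F"
    by (rule Lim_transform_eventually) (use E in \<open>auto elim!: eventually_mono simp: canon(2)[OF A _ u]\<close>)
qed

text \<open>
  Any linear functional \<open>\<phi>\<close> on the dual agrees on a finite set \<open>U\<close> with the evaluation at some vector
  \<open>Q \<phi>\<close>. Since no bound on \<open>Q \<phi>\<close> is asserted, this is a matter of linear algebra. For the induction over \<open>U\<close> a uniform version is proved: \<open>P\<close> is a finite rank operator on the
  dual that fixes \<open>U\<close>, and \<open>Q\<close> is its transpose. If \<open>P\<close> does not fix a new element \<open>u\<close>, choose \<open>z\<close> on
  which \<open>u' = u - P u\<close> has the value 1 and add to \<open>P\<close> the rank one operator that sends \<open>v\<close> to the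
  multiple of \<open>u'\<close> by the value of \<open>v - P v\<close> at \<open>z\<close>; it vanishes on \<open>U\<close> and sends \<open>u\<close> to \<open>u'\<close>.
\<close>

lemma ex_finite_interpolation:
  assumes A: "dual_at A k" and U: "finite U" "U \<subseteq> level A (Suc k)"
  shows "\<exists>P Q. (\<forall>v\<in>level A (Suc k). P v \<in> level A (Suc k)) \<and> (\<forall>u\<in>U. P u = u) \<and>
    (\<forall>\<phi>. linear_map_on (scal A) (*) (level A (Suc k)) UNIV \<phi> \<longrightarrow>
       Q \<phi> \<in> level A k \<and> (\<forall>v\<in>level A (Suc k). pairing A k v (Q \<phi>) = \<phi> (P v)))"
    (is "\<exists>P Q. ?I U P Q")
  using U
proof (induction U rule: finite_induct)
  case empty
  note S = dual_at_subspaces[OF A]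
  define P :: "'b \<Rightarrow> 'b" where "P v = 0" for v
  define Q :: "('b \<Rightarrow> 'a) \<Rightarrow> 'b" where "Q \<phi> = 0" for \<phi>
  have "?I {} P Q"
    unfolding P_def Q_def
    using S by (auto simp: normed_subspaceD pairing_simps[OF A] linear_map_on_zero_diff(1)[OF _ S(2)])
  then show ?case by blast
next
  case (insert u U)
  note S1 = normed_subspaceD[OF dual_at_subspaces(1)[OF A]]
  note S2 = normed_subspaceD[OF dual_at_subspaces(2)[OF A]]
  let ?L = "linear_map_on (scal A) (*) (level A (Suc k)) UNIV"
  obtain P Q where PQ: "?I U P Q" using insert.IH insert.prems by auto
  note P = bspec[OF conjunct1[OF PQ]]
    and PU = bspec[OF conjunct1[OF conjunct2[OF PQ]]]
    and Q = PQ[THEN conjunct2, THEN conjunct2, THEN spec, THEN mp]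
  note Q1 = conjunct1[OF Q] and Q2 = bspec[OF conjunct2[OF Q]]
  have u: "u \<in> level A (Suc k)" using insert.prems by simp
  define u' where "u' = u - P u"
  have u': "u' \<in> level A (Suc k)" unfolding u'_def by (rule S2(6)[OF u P[OF u]])
  show ?case
  proof (cases "u' = 0")
    case True
    then have "P u = u" by (simp add: u'_def)
    then have "?I (insert u U) P Q" using PQ by simp
    then show ?thesis by (intro exI)
  next
    case False
    then obtain z0 where z0: "z0 \<in> level A k" "pairing A k u' z0 \<noteq> 0"
      using dual_eqI[OF A u' S2(4)] pairing_simps(8)[OF A] by metis
    define z where "z = scal A (1 / pairing A k u' z0) z0"
    have z: "z \<in> level A k" "pairing A k u' z = 1"
      using S1(7)[OF z0(1)] z0(2) pairing_simps(3)[OF A u' z0(1)] by (auto simp: z_def)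
    \<comment> \<open>A functional \<open>v\<close> takes at \<open>y\<close> the coefficient of \<open>u'\<close> in the new operator.\<close>
    define y where "y = z - Q (\<lambda>v. pairing A k v z)"
    note Qz = Q1[OF pairing_linear_left[OF A z(1)]] Q2[OF pairing_linear_left[OF A z(1)]]
    have y: "y \<in> level A k" unfolding y_def by (rule S1(6)[OF z(1) Qz(1)])
    have py: "pairing A k v y = pairing A k (v - P v) z" if "v \<in> level A (Suc k)" for v
      using that P Qz z(1) by (simp add: y_def pairing_simps[OF A])
    define P' where "P' v = P v + scal A (pairing A k (v - P v) z) u'" for v
    define Q' where "Q' \<phi> = Q \<phi> + scal A (\<phi> u') y" for \<phi>
    interpret vector_space "scal A" by (rule S2(1))
    have "?I (insert u U) P' Q'"
    proof (intro conjI ballI allI impI)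
      fix v assume "v \<in> level A (Suc k)"
      then show "P' v \<in> level A (Suc k)" unfolding P'_def by (intro S2(5,7) P u')
    next
      fix v assume v: "v \<in> insert u U"
      show "P' v = v"
      proof (cases "v = u")
        case True
        have "P' u = P u + u'" unfolding P'_def u'_def[symmetric] z(2) by simp
        then show ?thesis unfolding True by (simp add: u'_def)
      next
        case False
        then have "P v = v" using v PU by simp
        then show ?thesis using z(1) by (simp add: P'_def pairing_simps(8)[OF A])
      qed
    next
      fix \<phi> assume \<phi>: "?L \<phi>"
      show "Q' \<phi> \<in> level A k" unfolding Q'_def by (intro S1(5,7) Q1[OF \<phi>] y)
      fix v assume v: "v \<in> level A (Suc k)"
      have "pairing A k v (Q' \<phi>) = \<phi> (P v) + \<phi> u' * pairing A k (v - P v) z"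
        using v Q1[OF \<phi>] Q2[OF \<phi>] y S1(7)[OF y] by (simp add: Q'_def pairing_simps[OF A] py)
      also have "\<dots> = \<phi> (P' v)"
        using P[OF v] u' S2(7)[OF u'] linear_map_onD[OF \<phi>] by (simp add: P'_def mult.commute)
      finally show "pairing A k v (Q' \<phi>) = \<phi> (P' v)" .
    qed
    then show ?thesis by (intro exI)
  qed
qed

text \<open>
  The net is indexed by the finite sets \<open>U\<close> of functionals, and its elements beyond \<open>U\<close> take exactly the
  values prescribed by \<open>a\<close> on \<open>U\<close>.
\<close>

lemma ex_weak_star_net:
  assumes A: "dual_at A k" "dual_at A (Suc k)" and a: "a \<in> level A (k + 2)"
  shows "\<exists>F. weak_star_net A k F a"
proof -
  have a': "a \<in> level A (Suc (Suc k))" using a by simp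
  define E where "E u = {x \<in> level A k. pairing A k u x = pairing A (Suc k) a u}" for u
  define F where "F = (INF u\<in>level A (Suc k). principal (E u))"
  have 0: "0 \<in> level A (Suc k)" by (rule normed_subspaceD(4)[OF dual_at_subspaces(2)[OF A(1)]])
  have "F \<noteq> bot" unfolding F_def
  proof (rule INF_filter_not_bot)
    fix U assume U: "U \<subseteq> level A (Suc k)" "finite U"
    have lin: "linear_map_on (scal A) (*) (level A (Suc k)) UNIV (pairing A (Suc k) a)"
      using pairing_functional[OF A(2) a'] by (simp add: bounded_linear_map_on_def)
    obtain P Q where "\<forall>u\<in>U. P u = u" "Q (pairing A (Suc k) a) \<in> level A k"
      "\<forall>v\<in>level A (Suc k). pairing A k v (Q (pairing A (Suc k) a)) = pairing A (Suc k) a (P v)"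
      using ex_finite_interpolation[OF A(1) U(2,1)] lin by metis
    then have "Q (pairing A (Suc k) a) \<in> (\<Inter>u\<in>U. E u)" using U by (auto simp: E_def)
    then show "(INF u\<in>U. principal (E u)) \<noteq> bot"
      unfolding INF_principal_finite[OF U(2)] principal_eq_bot_iff by blast
  qed
  moreover have ev: "\<forall>\<^sub>F x in F. x \<in> E u" if "u \<in> level A (Suc k)" for u
    unfolding F_def by (rule eventually_INF1[OF that]) (simp add: eventually_principal)
  moreover have "\<forall>\<^sub>F x in F. x \<in> level A k" using ev[OF 0] by (rule eventually_mono) (simp add: E_def)
  moreover have "limitin (weak_star_topology A (Suc k)) (canon A k) a F"
    unfolding limitin_weak_star_topology[OF A(2)]
  proof (intro conjI ballI)
    show "a \<in> level A (Suc (Suc k))" by (rule a')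
    show "\<forall>\<^sub>F x in F. canon A k x \<in> level A (Suc (Suc k))"
      using ev[OF 0] by (rule eventually_mono) (simp add: E_def canon(1)[OF A])
    fix u assume u: "u \<in> level A (Suc k)"
    have "\<forall>\<^sub>F x in F. pairing A (Suc k) (canon A k x) u = pairing A (Suc k) a u"
      using ev[OF u] by (rule eventually_mono) (simp add: E_def canon(2)[OF A _ u])
    then show "((\<lambda>x. pairing A (Suc k) (canon A k x) u) \<longlongrightarrow> pairing A (Suc k) a u) F"
      by (rule tendsto_eventually)
  qed
  ultimately show ?thesis unfolding weak_star_net_def by blast
qed

text \<open>
  The inner limit \<open>w x\<close> must be the functional \<open>u \<mapsto> \<langle>b, y \<mapsto> \<langle>u, f x y\<rangle>\<rangle>\<close>, because \<open>y \<mapsto> \<langle>u, f x y\<rangle>\<close> is an element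
  of the dual, on which weak* convergence is tested. For the same reason the outer limit of
  \<open>x \<mapsto> \<langle>w x, u\<rangle>\<close>, again an element of the dual, is its value under \<open>a\<close>.
\<close>

lemma iterated_limit_iff:
  assumes A: "dual_at A k" "dual_at A (Suc k)"
    and B: "dual_at B k" "dual_at B (Suc k)"
    and C: "dual_at C k" "dual_at C (Suc k)"
    and f: "bounded_bilinear_map_on (scal A) (scal B) (scal C) (level A k) (level B k) (level C k) f"
    and F: "weak_star_net A k F a" and G: "weak_star_net B k G b"
  shows "(\<exists>w. (\<forall>x\<in>level A k. limitin (weak_star_topology C (Suc k)) (\<lambda>y. canon C k (f x y)) (w x) G) \<and>
      limitin (weak_star_topology C (Suc k)) w z F) \<longleftrightarrow> z = arens_ext A B C k f a b"
proof -
  note NF = weak_star_netD[OF A F] and NG = weak_star_netD[OF B G]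
  note ext = arens_ext[OF A B C f]
  note t1 = tadj[OF B(1) C(1) f dual_at_subspaces(1)[OF A(1)]]
  note fC = bounded_bilinear_map_onD(3)[OF f]
  have b: "b \<in> level B (Suc (Suc k))" using NG(3) by simp
  have ab: "arens_ext A B C k f a b \<in> level C (Suc (Suc k))"
    using bounded_bilinear_map_onD(3)[OF ext(1) NF(3) NG(3)] by simp
  let ?t = "\<lambda>x u. pairing B (Suc k) b (tadj B k C k f u x)"
  have inner: "((\<lambda>y. pairing C (Suc k) (canon C k (f x y)) u) \<longlongrightarrow> ?t x u) G"
    if x: "x \<in> level A k" and u: "u \<in> level C (Suc k)" for x u
  proof (rule Lim_transform_eventually)
    show "(pairing B k (tadj B k C k f u x) \<longlongrightarrow> ?t x u) G"
      by (rule NG(4)) (rule bounded_bilinear_map_onD(3)[OF t1(1) u x])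
    show "\<forall>\<^sub>F y in G. pairing B k (tadj B k C k f u x) y = pairing C (Suc k) (canon C k (f x y)) u"
      using NG(2) by (rule eventually_mono) (simp add: t1(2)[OF u x] canon(2)[OF C fC[OF x] u])
  qed
  have outer: "((\<lambda>x. ?t x u) \<longlongrightarrow> pairing C (Suc k) (arens_ext A B C k f a b) u) F"
    if u: "u \<in> level C (Suc k)" for u
  proof (rule Lim_transform_eventually)
    show "(pairing A k (tadj A k B (Suc k) (tadj B k C k f) b u) \<longlongrightarrow>
        pairing C (Suc k) (arens_ext A B C k f a b) u) F"
      unfolding ext(2)[OF NF(3) NG(3) u] by (rule NF(4)[OF ext(4)[OF NG(3) u]])
    show "\<forall>\<^sub>F x in F. pairing A k (tadj A k B (Suc k) (tadj B k C k f) b u) x = ?t x u"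
      using NF(2) by (rule eventually_mono) (rule ext(3)[OF NG(3) u])
  qed
  show ?thesis
  proof
    assume "\<exists>w. (\<forall>x\<in>level A k. limitin (weak_star_topology C (Suc k)) (\<lambda>y. canon C k (f x y)) (w x) G) \<and>
      limitin (weak_star_topology C (Suc k)) w z F"
    then obtain w where
      w1: "\<And>x. x \<in> level A k \<Longrightarrow> limitin (weak_star_topology C (Suc k)) (\<lambda>y. canon C k (f x y)) (w x) G"
      and w2: "limitin (weak_star_topology C (Suc k)) w z F" by blast
    have w: "pairing C (Suc k) (w x) u = ?t x u" if x: "x \<in> level A k" and u: "u \<in> level C (Suc k)" for x u
      using tendsto_unique[OF NG(1) _ inner[OF x u]] w1[OF x] u
      by (simp add: limitin_weak_star_topology[OF C(2)])
    have z: "z \<in> level C (Suc (Suc k))" using w2 by (simp add: limitin_weak_star_topology[OF C(2)])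
    show "z = arens_ext A B C k f a b"
    proof (rule dual_eqI[OF C(2) z ab])
      fix u assume u: "u \<in> level C (Suc k)"
      have "((\<lambda>x. pairing C (Suc k) (w x) u) \<longlongrightarrow> pairing C (Suc k) z u) F"
        using w2 u by (simp add: limitin_weak_star_topology[OF C(2)])
      then have "((\<lambda>x. ?t x u) \<longlongrightarrow> pairing C (Suc k) z u) F"
        by (rule Lim_transform_eventually) (use NF(2) in \<open>auto elim!: eventually_mono simp: w[OF _ u]\<close>)
      then show "pairing C (Suc k) z u = pairing C (Suc k) (arens_ext A B C k f a b) u"
        using outer[OF u] by (rule tendsto_unique[OF NF(1)])
    qed
  next
    assume z: "z = arens_ext A B C k f a b"
    define w where "w x = rep C (Suc k) (\<lambda>u. ?t x u)" for x
    have "functional C (Suc k) (\<lambda>u. ?t x u)" if x: "x \<in> level A k" for x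
      by (rule bounded_linear_map_on_comp[OF bounded_bilinear_map_onD(2)[OF t1(1) x]
            pairing_functional[OF B(2) b]])
    note R = rep[OF C(2) this, folded w_def]
    have "limitin (weak_star_topology C (Suc k)) (\<lambda>y. canon C k (f x y)) (w x) G"
      if x: "x \<in> level A k" for x
      unfolding limitin_weak_star_topology[OF C(2)]
      using inner[OF x] R[OF x] NG(2) canon(1)[OF C fC[OF x]] by (auto elim: eventually_mono)
    moreover have "limitin (weak_star_topology C (Suc k)) w z F"
      unfolding limitin_weak_star_topology[OF C(2)]
    proof (intro conjI ballI)
      show "z \<in> level C (Suc (Suc k))" using z ab by simp
      show "\<forall>\<^sub>F x in F. w x \<in> level C (Suc (Suc k))"
        using NF(2) by (rule eventually_mono) (rule R(1))
      fix u assume u: "u \<in> level C (Suc k)"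
      show "((\<lambda>x. pairing C (Suc k) (w x) u) \<longlongrightarrow> pairing C (Suc k) z u) F"
        unfolding z using outer[OF u]
        by (rule Lim_transform_eventually) (use NF(2) in \<open>auto elim!: eventually_mono simp: R(2)[OF _ u]\<close>)
    qed
    ultimately show "\<exists>w. (\<forall>x\<in>level A k. limitin (weak_star_topology C (Suc k)) (\<lambda>y. canon C k (f x y)) (w x) G) \<and>
      limitin (weak_star_topology C (Suc k)) w z F" by blast
  qed
qed

section \<open>The product and the actions at even levels\<close>

lemma ext_left_eq_arens_ext:
  assumes A: "dual_at A k" "dual_at A (Suc k)" and X: "dual_at X k" "dual_at X (Suc k)"
    and l: "bounded_bilinear_map_on (scal A) (scal X) (scal X) (level A k) (level X k) (level X k) l"
    and b: "b \<in> level A (k + 2)" and y: "y \<in> level X (k + 2)"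
  shows "ext_left A X k l b y = arens_ext A X X k l b y"
proof -
  obtain F G where FG: "weak_star_net A k F b" "weak_star_net X k G y"
    using ex_weak_star_net[OF A b] ex_weak_star_net[OF X y] by blast
  show ?thesis unfolding ext_left_def
  proof (rule the_equality, goal_cases)
    case 1
    then show ?case by (intro allI impI iterated_limit_iff[OF A X X l, THEN iffD2]) auto
  next
    case (2 z)
    then show ?case by (intro iterated_limit_iff[OF A X X l FG, THEN iffD1]) (use FG in blast)
  qed
qed

text \<open>
  In the right action the algebra is the second argument of \<open>r\<close>, and its net is the inner one; so
  this is the first, not the second, Arens extension of \<open>r\<close> as well.
\<close>

lemma ext_right_eq_arens_ext:
  assumes A: "dual_at A k" "dual_at A (Suc k)" and X: "dual_at X k" "dual_at X (Suc k)"
    and r: "bounded_bilinear_map_on (scal X) (scal A) (scal X) (level X k) (level A k) (level X k) r"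
    and b: "b \<in> level A (k + 2)" and y: "y \<in> level X (k + 2)"
  shows "ext_right A X k r y b = arens_ext X A X k r y b"
proof -
  obtain F G where FG: "weak_star_net A k F b" "weak_star_net X k G y"
    using ex_weak_star_net[OF A b] ex_weak_star_net[OF X y] by blast
  show ?thesis unfolding ext_right_def
  proof (rule the_equality, goal_cases)
    case 1
    then show ?case by (intro allI impI iterated_limit_iff[OF X A X r, THEN iffD2]) auto
  next
    case (2 z)
    then show ?case by (intro iterated_limit_iff[OF X A X r FG(2,1), THEN iffD1]) (use FG in blast)
  qed
qed

lemma bounded_bilinear_map_on_cong:
  assumes "bounded_bilinear_map_on s t u E F G f" "normed_subspace s E" "normed_subspace t F"
    and "\<And>x y. x \<in> E \<Longrightarrow> y \<in> F \<Longrightarrow> g x y = f x y"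
  shows "bounded_bilinear_map_on s t u E F G g"
  using assms(1) normed_subspaceD(5,7)[OF assms(2)] normed_subspaceD(5,7)[OF assms(3)]
  by (simp add: bounded_bilinear_map_on_def linear_map_on_def assms(4) cong: ball_cong)

lemma tower_operations_bounded_bilinear:
  assumes "even n" "dual_tower n A" "dual_tower n X"
    and "banach_algebra (scal A) (level A 0) m"
    and "banach_bimodule (scal A) (level A 0) m (scal X) (level X 0) l r"
  shows "bounded_bilinear_map_on (scal A) (scal A) (scal A) (level A n) (level A n) (level A n) (mult_at A m n)"
    and "bounded_bilinear_map_on (scal A) (scal X) (scal X) (level A n) (level X n) (level X n) (left_at A X l n)"
    and "bounded_bilinear_map_on (scal X) (scal A) (scal X) (level X n) (level A n) (level X n) (right_at A X r n)"
proof -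
  let ?B = "\<lambda>n. bounded_bilinear_map_on (scal A) (scal A) (scal A) (level A n) (level A n) (level A n) (mult_at A m n) \<and>
    bounded_bilinear_map_on (scal A) (scal X) (scal X) (level A n) (level X n) (level X n) (left_at A X l n) \<and>
    bounded_bilinear_map_on (scal X) (scal A) (scal X) (level X n) (level A n) (level X n) (right_at A X r n)"
  have "even k \<Longrightarrow> k \<le> n \<Longrightarrow> ?B k" for k
  proof (induction k rule: nat_induct2)
    case 0
    then show ?case using assms(4,5)
      unfolding banach_algebra_def banach_bimodule_def mult_at.simps left_at.simps right_at.simps by blast
  next
    case 1
    then show ?case by simp
  next
    case (step k)
    have "even k" "k \<le> n" using step(2,3) by simp_all
    then have IH: "?B k" by (rule step(1))
    have A: "dual_at A k" "dual_at A (Suc k)" and X: "dual_at X k" "dual_at X (Suc k)"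
      using step(3) dual_tower_dual_at[OF assms(2)] dual_tower_dual_at[OF assms(3)] by auto
    have S: "normed_subspace (scal A) (level A (k + 2))" "normed_subspace (scal X) (level X (k + 2))"
      using dual_at_subspaces(2)[OF A(2)] dual_at_subspaces(2)[OF X(2)] by auto
    note l = conjunct1[OF conjunct2[OF IH]] and r = conjunct2[OF conjunct2[OF IH]]
    have "bounded_bilinear_map_on (scal A) (scal A) (scal A) (level A (k+2)) (level A (k+2)) (level A (k+2)) (mult_at A m (k+2))"
      using arens_ext(1)[OF A A A conjunct1[OF IH]] by (simp add: arens_eq_arens_ext)
    moreover have "bounded_bilinear_map_on (scal A) (scal X) (scal X) (level A (k+2)) (level X (k+2)) (level X (k+2)) (left_at A X l (k+2))"
      by (rule bounded_bilinear_map_on_cong[OF arens_ext(1)[OF A X X l] S])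
        (use ext_left_eq_arens_ext[OF A X l] in simp)
    moreover have "bounded_bilinear_map_on (scal X) (scal A) (scal X) (level X (k+2)) (level A (k+2)) (level X (k+2)) (right_at A X r (k+2))"
      by (rule bounded_bilinear_map_on_cong[OF arens_ext(1)[OF X A X r] S(2,1)])
        (use ext_right_eq_arens_ext[OF A X r] in simp)
    ultimately show ?case by blast
  qed
  then have "?B n" using assms(1) by blast
  then show "bounded_bilinear_map_on (scal A) (scal A) (scal A) (level A n) (level A n) (level A n) (mult_at A m n)"
    "bounded_bilinear_map_on (scal A) (scal X) (scal X) (level A n) (level X n) (level X n) (left_at A X l n)"
    "bounded_bilinear_map_on (scal X) (scal A) (scal X) (level X n) (level A n) (level X n) (right_at A X r n)"
    by blast+
qed

section \<open>The second adjoint of a derivation\<close>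

text \<open>
  If the second argument lies in the space itself, the extension is the second adjoint of the
  partial map \<open>x \<mapsto> f x y\<close>. This makes \<open>y T''(x)\<close> computable for \<open>x\<close> in the algebra.
\<close>

lemma arens_ext_canon_right:
  assumes A: "dual_at A k" "dual_at A (Suc k)"
    and B: "dual_at B k" "dual_at B (Suc k)"
    and C: "dual_at C k" "dual_at C (Suc k)"
    and f: "bounded_bilinear_map_on (scal A) (scal B) (scal C) (level A k) (level B k) (level C k) f"
    and a: "a \<in> level A (k + 2)" and y: "y \<in> level B k" and u: "u \<in> level C (Suc k)"
  shows "pairing C (Suc k) (arens_ext A B C k f a (canon B k y)) u =
    pairing A (Suc k) a (adj A k C k (\<lambda>x. f x y) u)"
proof -
  note ext = arens_ext[OF A B C f]
  note t1 = tadj[OF B(1) C(1) f dual_at_subspaces(1)[OF A(1)]]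
  note R = adj[OF A(1) C(1) bounded_bilinear_map_onD(2)[OF f y]]
  have cy: "canon B k y \<in> level B (k + 2)" using canon(1)[OF B y] by simp
  have Ru: "adj A k C k (\<lambda>x. f x y) u \<in> level A (Suc k)"
    using R(1) u by (auto simp: bounded_linear_map_on_def linear_map_on_def)
  have "tadj A k B (Suc k) (tadj B k C k f) (canon B k y) u = adj A k C k (\<lambda>x. f x y) u"
  proof (rule dual_eqI[OF A(1) ext(4)[OF cy u] Ru])
    fix x assume x: "x \<in> level A k"
    show "pairing A k (tadj A k B (Suc k) (tadj B k C k f) (canon B k y) u) x =
        pairing A k (adj A k C k (\<lambda>x. f x y) u) x"
      by (simp add: ext(3)[OF cy u x] canon(2)[OF B y bounded_bilinear_map_onD(3)[OF t1(1) u x]]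
          t1(2)[OF u x y] R(2)[OF u x])
  qed
  then show ?thesis by (simp add: ext(2)[OF a cy u])
qed

lemma adj2_canon:
  assumes A: "dual_at A i" "dual_at A (Suc i)" and B: "dual_at B j" "dual_at B (Suc j)"
    and T: "bounded_linear_map_on (scal A) (scal B) (level A i) (level B j) T"
    and x: "x \<in> level A i"
  shows "adj2 A i B j T (canon A i x) = canon B j (T x)"
proof -
  note T1 = adj[OF A(1) B(1) T] and T2 = adj2[OF A B T]
  have Tx: "T x \<in> level B j" using T x by (auto simp: bounded_linear_map_on_def linear_map_on_def)
  have cx: "canon A i x \<in> level A (i + 2)" using canon(1)[OF A x] by simp
  have T2x: "adj2 A i B j T (canon A i x) \<in> level B (Suc (Suc j))"
    using T2(1) cx by (auto simp: bounded_linear_map_on_def linear_map_on_def)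
  show ?thesis
  proof (rule dual_eqI[OF B(2) T2x canon(1)[OF B Tx]])
    fix v assume v: "v \<in> level B (Suc j)"
    have "adj A i B j T v \<in> level A (Suc i)"
      using T1(1) v by (auto simp: bounded_linear_map_on_def linear_map_on_def)
    then show "pairing B (Suc j) (adj2 A i B j T (canon A i x)) v = pairing B (Suc j) (canon B j (T x)) v"
      by (simp add: T2(2)[OF cx v] canon(2)[OF A x] canon(2)[OF B Tx v] T1(2)[OF v x])
  qed
qed

text \<open>
  Only the summand with \<open>T\<close> needs an argument beyond unwinding: there \<open>a\<close> and \<open>b\<close> appear in the
  opposite order of evaluation on the two sides, so that two iterated limits have to be
  exchanged. The continuity assumption permits this, as \<open>a\<close> is approximated by a net in the algebra.
\<close>

lemma adj2_product_rule:
  assumes A: "dual_at A k" "dual_at A (Suc k)"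
    and X: "dual_at X k" "dual_at X (Suc k)" "dual_at X (k + 2)"
    and m: "bounded_bilinear_map_on (scal A) (scal A) (scal A) (level A k) (level A k) (level A k) m"
    and l: "bounded_bilinear_map_on (scal A) (scal X) (scal X) (level A k) (level X k) (level X k) l"
    and r: "bounded_bilinear_map_on (scal X) (scal A) (scal X) (level X k) (level A k) (level X k) r"
    and T: "bounded_linear_map_on (scal A) (scal A) (level A k) (level A k) T"
    and S: "bounded_linear_map_on (scal A) (scal A) (level A k) (level A k) S"
    and D: "bounded_linear_map_on (scal A) (scal X) (level A k) (level X (Suc k)) D"
    and rule: "\<And>x y. x \<in> level A k \<Longrightarrow> y \<in> level A k \<Longrightarrow>
      D (m x y) = dual_left X k r (T x) (D y) + dual_right X k l (D x) (S y)"
    and l2: "\<And>b y. b \<in> level A (k + 2) \<Longrightarrow> y \<in> level X (k + 2) \<Longrightarrow> l2 b y = arens_ext A X X k l b y"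
    and r2: "\<And>b y. b \<in> level A (k + 2) \<Longrightarrow> y \<in> level X (k + 2) \<Longrightarrow> r2 y b = arens_ext X A X k r y b"
    and cont: "\<And>y. y \<in> level X (k + 2) \<Longrightarrow>
      continuous_map (weak_star_topology A (Suc k)) (weak_topology X (k + 2)) (\<lambda>a. r2 y (adj2 A k A k T a))"
    and a: "a \<in> level A (k + 2)" and b: "b \<in> level A (k + 2)"
  shows "adj2 A k X (Suc k) D (arens_ext A A A k m a b) =
    dual_left X (k + 2) r2 (adj2 A k A k T a) (adj2 A k X (Suc k) D b) +
    dual_right X (k + 2) l2 (adj2 A k X (Suc k) D a) (adj2 A k A k S b)"
proof -
  have mem: "bounded_linear_map_on s t E F f \<Longrightarrow> x \<in> E \<Longrightarrow> f x \<in> F"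
    for s t E F x and f :: "_ \<Rightarrow> _"
    by (auto simp: bounded_linear_map_on_def linear_map_on_def)
  have X2: "dual_at X (Suc (Suc k))" using X(3) by simp
  define D1 where "D1 = adj A k X (Suc k) D"
  define D2 where "D2 = adj2 A k X (Suc k) D"
  define T2 where "T2 = adj2 A k A k T"
  define S2 where "S2 = adj2 A k A k S"
  note D1 = adj[OF A(1) X(2) D, folded D1_def]
  note D2 = adj2[OF A X(2) X2 D, folded D1_def D2_def]
  note T2 = adj2[OF A A T, folded T2_def]
  note S1 = adj[OF A(1) A(1) S] and S2 = adj2[OF A A S, folded S2_def]
  note em = arens_ext[OF A A A m] and el = arens_ext[OF A X(1,2) X(1,2) l]
    and er = arens_ext[OF X(1,2) A X(1,2) r]
  note tm = tadj[OF A(1) A(1) m dual_at_subspaces(1)[OF A(1)]]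
  note tl = tadj[OF X(1) X(1) l dual_at_subspaces(1)[OF A(1)]]
  have D1m: "D1 y \<in> level A (Suc k)" if "y \<in> level X (k + 2)" for y
    using mem[OF D1(1)] that by simp
  have D2m: "D2 c \<in> level X (Suc (k + 2))" if "c \<in> level A (k + 2)" for c
    using mem[OF D2(1) that] by simp
  note T2m = mem[OF T2(1)] and S2m = mem[OF S2(1)]
  have r2m: "r2 y c \<in> level X (k + 2)" if "y \<in> level X (k + 2)" "c \<in> level A (k + 2)" for y c
    using r2[OF that(2,1)] bounded_bilinear_map_onD(3)[OF er(1) that] by simp
  have l2m: "l2 c y \<in> level X (k + 2)" if "y \<in> level X (k + 2)" "c \<in> level A (k + 2)" for y c
    using l2[OF that(2,1)] bounded_bilinear_map_onD(3)[OF el(1) that(2,1)] by simp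
  have D2e: "pairing X (k + 2) (D2 c) y = pairing A (Suc k) c (D1 y)"
    if "c \<in> level A (k + 2)" "y \<in> level X (k + 2)" for c y
    using D2(2) that by simp
  have D1e: "pairing A k (D1 y) x = pairing X (Suc k) y (D x)"
    if "y \<in> level X (k + 2)" "x \<in> level A k" for x y
    using D1(2) that by simp
  have ab: "arens_ext A A A k m a b \<in> level A (k + 2)" by (rule bounded_bilinear_map_onD(3)[OF em(1) a b])
  have r2b: "bounded_linear_map_on (scal X) (scal X) (level X (k+2)) (level X (k+2)) (\<lambda>y. r2 y c)"
    if c: "c \<in> level A (k + 2)" for c
    using bounded_bilinear_map_onD(2)[OF er(1) c] normed_subspaceD(5,7)[OF dual_at_subspaces(1)[OF X(3)]]
    by (simp add: bounded_linear_map_on_def linear_map_on_def r2[OF c])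
  have l2b: "bounded_linear_map_on (scal X) (scal X) (level X (k+2)) (level X (k+2)) (l2 c)"
    if c: "c \<in> level A (k + 2)" for c
    using bounded_bilinear_map_onD(1)[OF el(1) c] normed_subspaceD(5,7)[OF dual_at_subspaces(1)[OF X(3)]]
    by (simp add: bounded_linear_map_on_def linear_map_on_def l2[OF c])
  note L = adj[OF X(3) X(3) r2b[OF T2m[OF a]], folded dual_left_eq_adj]
  have dr: "dual_right X (k + 2) l2 u c = adj X (k + 2) X (k + 2) (l2 c) u" for u c
    by (simp add: dual_right_def adj_def)
  note R = adj[OF X(3) X(3) l2b[OF S2m[OF b]]]
  have Lm: "dual_left X (k + 2) r2 (T2 a) (D2 b) \<in> level X (Suc (k + 2))" by (rule mem[OF L(1) D2m[OF b]])
  have Rm: "dual_right X (k + 2) l2 (D2 a) (S2 b) \<in> level X (Suc (k + 2))" unfolding dr by (rule mem[OF R(1) D2m[OF a]])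
  have "D2 (arens_ext A A A k m a b) =
    dual_left X (k + 2) r2 (T2 a) (D2 b) + dual_right X (k + 2) l2 (D2 a) (S2 b)" (is "_ = ?L + ?R")
  proof (rule dual_eqI[OF X(3) D2m[OF ab]])
    show "?L + ?R \<in> level X (Suc (k + 2))"
      by (rule normed_subspaceD(5)[OF dual_at_subspaces(2)[OF X(3)] Lm Rm])
    fix y assume y: "y \<in> level X (k + 2)"
    then have y': "y \<in> level X (Suc (Suc k))" by simp
    \<comment> \<open>The functional \<open>x \<mapsto> \<langle>b, c \<mapsto> \<langle>y, D(xc)\<rangle>\<rangle>\<close>, in which \<open>x\<close> is still in the algebra.\<close>
    define \<Theta> where "\<Theta> = tadj A k A (Suc k) (tadj A k A k m) b (D1 y)"
    have \<Theta>: "\<Theta> \<in> level A (Suc k)" unfolding \<Theta>_def by (rule em(4)[OF b D1m[OF y]])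
    let ?z = "l2 (S2 b) y"
    have z: "?z \<in> level X (k + 2)" by (rule l2m[OF y S2m[OF b]])
    \<comment> \<open>What remains of \<open>\<Theta>\<close> after removing the summand with \<open>S\<close>. As a difference of elements of
      the dual it lies in the dual, which a definition by the formula in \<open>key\<close> would leave to prove.\<close>
    define \<Psi> where "\<Psi> = \<Theta> - D1 ?z"
    have \<Psi>: "\<Psi> \<in> level A (Suc k)" unfolding \<Psi>_def
      by (rule normed_subspaceD(6)[OF dual_at_subspaces(2)[OF A(1)] \<Theta> D1m[OF z]])
    have key: "pairing A k \<Psi> x = pairing X (k + 2) (D2 b) (r2 y (T2 (canon A k x)))"
      if x: "x \<in> level A k" for x
    proof -
      have Tx: "T x \<in> level A k" and Dx: "D x \<in> level X (Suc k)" using mem[OF T x] mem[OF D x] .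
      have cTx: "canon A k (T x) \<in> level A (k + 2)" using canon(1)[OF A Tx] by simp
      let ?p = "r2 y (canon A k (T x))"
      let ?q = "tadj A k X (Suc k) (tadj X k X k l) y (D x)"
      have p: "?p \<in> level X (k + 2)" by (rule r2m[OF y cTx])
      have q: "?q \<in> level A (Suc k)" by (rule el(4)[OF y Dx])
      have Sq: "adj A k A k S ?q \<in> level A (Suc k)" by (rule mem[OF S1(1) q])
      note Ra = adj[OF X(1) X(1) bounded_bilinear_map_onD(2)[OF r Tx], folded dual_left_eq_adj]
      have "tadj A k A k m (D1 y) x = D1 ?p + adj A k A k S ?q"
      proof (rule dual_eqI[OF A(1) bounded_bilinear_map_onD(3)[OF tm(1) D1m[OF y] x]])
        show "D1 ?p + adj A k A k S ?q \<in> level A (Suc k)"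
          by (rule normed_subspaceD(5)[OF dual_at_subspaces(2)[OF A(1)] D1m[OF p] Sq])
        fix c assume c: "c \<in> level A k"
        have Dc: "D c \<in> level X (Suc k)" and Sc: "S c \<in> level A k" using mem[OF D c] mem[OF S c] .
        have i: "pairing X (Suc k) y (dual_left X k r (T x) (D c)) = pairing A k (D1 ?p) c"
          unfolding D1e[OF p c] dual_left_eq_adj
          unfolding r2[OF cTx y] arens_ext_canon_right[OF X(1,2) A X(1,2) r y Tx Dc] ..
        have ii: "pairing X (Suc k) y (dual_right X k l (D x) (S c)) = pairing A k (adj A k A k S ?q) c"
          unfolding S1(2)[OF q c] el(3)[OF y Dx Sc] dual_right_eq_tadj ..
        have "pairing A k (tadj A k A k m (D1 y) x) c = pairing X (Suc k) y (D (m x c))"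
          by (simp add: tm(2)[OF D1m[OF y] x c] D1e[OF y bounded_bilinear_map_onD(3)[OF m x c]])
        also have "\<dots> = pairing X (Suc k) y (dual_left X k r (T x) (D c)) +
            pairing X (Suc k) y (dual_right X k l (D x) (S c))"
          unfolding rule[OF x c] dual_right_eq_tadj
          by (rule pairing_simps(1)[OF X(2) y' mem[OF Ra(1) Dc] bounded_bilinear_map_onD(3)[OF tl(1) Dx Sc]])
        also have "\<dots> = pairing A k (D1 ?p + adj A k A k S ?q) c"
          unfolding i ii by (rule pairing_simps(4)[OF A(1) D1m[OF p] Sq c, symmetric])
        finally show "pairing A k (tadj A k A k m (D1 y) x) c = pairing A k (D1 ?p + adj A k A k S ?q) c" .
      qed
      then have "pairing A k \<Theta> x = pairing A (Suc k) b (D1 ?p + adj A k A k S ?q)"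
        unfolding \<Theta>_def em(3)[OF b D1m[OF y] x] by simp
      also have "\<dots> = pairing A (Suc k) b (D1 ?p) + pairing A (Suc k) b (adj A k A k S ?q)"
        using pairing_simps(1)[OF A(2)] b D1m[OF p] Sq by simp
      also have "\<dots> = pairing X (k + 2) (D2 b) ?p + pairing A k (D1 ?z) x"
        unfolding D2e[OF b p] S2(2)[OF b q, symmetric] D1e[OF z x]
        unfolding l2[OF S2m[OF b] y] el(2)[OF S2m[OF b] y Dx] ..
      finally show ?thesis
        unfolding \<Psi>_def pairing_simps(5)[OF A(1) \<Theta> D1m[OF z] x] T2_def adj2_canon[OF A A T x]
        by simp
    qed
    \<comment> \<open>Both sides of \<open>key\<close> converge along a net with limit \<open>a\<close>: the left one because \<open>\<Psi>\<close> is in the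
      dual, the right one by \<open>cont\<close>.\<close>
    obtain F where F: "weak_star_net A k F a" using ex_weak_star_net[OF A a] by blast
    note NF = weak_star_netD[OF A F]
    have "limitin (weak_topology X (k + 2)) ((\<lambda>a. r2 y (T2 a)) \<circ> canon A k) (r2 y (T2 a)) F"
      using F unfolding weak_star_net_def
      by (intro continuous_map_limit[OF cont[OF y, folded T2_def]]) auto
    then have "((\<lambda>x. pairing X (k + 2) (D2 b) (r2 y (T2 (canon A k x)))) \<longlongrightarrow>
        pairing X (k + 2) (D2 b) (r2 y (T2 a))) F"
      using D2m[OF b] unfolding limitin_weak_topology[OF X(3)] comp_def by simp
    moreover have "((\<lambda>x. pairing X (k + 2) (D2 b) (r2 y (T2 (canon A k x)))) \<longlongrightarrow> pairing A (Suc k) a \<Psi>) F"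
      by (rule Lim_transform_eventually[OF NF(4)[OF \<Psi>]])
        (rule eventually_mono[OF NF(2)], rule key)
    ultimately have lim: "pairing A (Suc k) a \<Psi> = pairing X (k + 2) (D2 b) (r2 y (T2 a))"
      by (intro tendsto_unique[OF NF(1)])
    have "pairing X (k + 2) (D2 (arens_ext A A A k m a b)) y = pairing A (Suc k) a \<Theta>"
      unfolding D2e[OF ab y] \<Theta>_def by (rule em(2)[OF a b D1m[OF y]])
    also have "\<dots> = pairing A (Suc k) a \<Psi> + pairing A (Suc k) a (D1 ?z)"
      using pairing_simps(2)[OF A(2) _ \<Theta> D1m[OF z], of a] a by (simp add: \<Psi>_def)
    also have "\<dots> = pairing X (k + 2) ?L y + pairing X (k + 2) ?R y"
      unfolding lim L(2)[OF D2m[OF b] y] dr R(2)[OF D2m[OF a] y] D2e[OF a z] ..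
    also have "\<dots> = pairing X (k + 2) (?L + ?R) y"
      by (rule pairing_simps(4)[OF X(3) Lm Rm y, symmetric])
    finally show "pairing X (k + 2) (D2 (arens_ext A A A k m a b)) y = pairing X (k + 2) (?L + ?R) y" .
  qed
  then show ?thesis by (simp add: D2_def T2_def S2_def)
qed

theorem mainTheorem2:
  fixes A :: "('k::real_normed_field, 'a::real_normed_vector) tower"
    and X :: "('k, 'x::real_normed_vector) tower"
    and m :: "'a \<Rightarrow> 'a \<Rightarrow> 'a"
    and l :: "'a \<Rightarrow> 'x \<Rightarrow> 'x"
    and r :: "'x \<Rightarrow> 'a \<Rightarrow> 'x"
    and n :: nat
    and T S :: "'a \<Rightarrow> 'a"
    and D :: "'a \<Rightarrow> 'x"
  assumes "even n"
    and "dual_tower (n + 2) A"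
    and "dual_tower (n + 3) X"
    and "banach_algebra (scal A) (level A 0) m"
    and "banach_bimodule (scal A) (level A 0) m (scal X) (level X 0) l r"
    and "linear_map_on (scal A) (scal A) (level A n) (level A n) T"
    and "continuous_on (level A n) T"
    and "linear_map_on (scal A) (scal A) (level A n) (level A n) S"
    and "continuous_on (level A n) S"
    and "\<And>x. x \<in> level X (n + 2) \<Longrightarrow>
           continuous_map (weak_star_topology A (n + 1)) (weak_topology X (n + 2))
             (\<lambda>a. right_at A X r (n + 2) x (adj2 A n A n T a))"
    and "TS_derivation (scal A) (level A n) (mult_at A m n)
           (scal X) (level X (n + 1))
           (dual_left X n (right_at A X r n)) (dual_right X n (left_at A X l n))
           T S D"
  shows "TS_derivation (scal A) (level A (n + 2)) (mult_at A m (n + 2))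
           (scal X) (level X (n + 3))
           (dual_left X (n + 2) (right_at A X r (n + 2)))
           (dual_right X (n + 2) (left_at A X l (n + 2)))
           (adj2 A n A n T) (adj2 A n A n S) (adj2 A n X (n + 1) D)"
proof -
  have dA: "dual_at A n" "dual_at A (Suc n)"
    using dual_tower_dual_at[OF assms(2)] by auto
  have dX: "dual_at X n" "dual_at X (Suc n)" "dual_at X (n + 2)"
    using dual_tower_dual_at[OF assms(3)] by auto
  have tow: "dual_tower n A" "dual_tower n X"
    using assms(2,3) by (auto simp: dual_tower_def)
  note ops = tower_operations_bounded_bilinear[OF assms(1) tow assms(4,5)]
  note NA = dual_at_subspaces(1)[OF dA(1)]
  have NA2: "normed_subspace (scal A) (level A (n + 2))" using dual_at_subspaces(2)[OF dA(2)] by simp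
  have T: "bounded_linear_map_on (scal A) (scal A) (level A n) (level A n) T"
    by (rule continuous_linear_map_on_bounded[OF assms(6,7) NA NA])
  have S: "bounded_linear_map_on (scal A) (scal A) (level A n) (level A n) S"
    by (rule continuous_linear_map_on_bounded[OF assms(8,9) NA NA])
  have D: "bounded_linear_map_on (scal A) (scal X) (level A n) (level X (Suc n)) D"
    and rule: "\<And>x y. x \<in> level A n \<Longrightarrow> y \<in> level A n \<Longrightarrow> D (mult_at A m n x y) =
      dual_left X n (right_at A X r n) (T x) (D y) + dual_right X n (left_at A X l n) (D x) (S y)"
    using assms(11) by (auto simp: TS_derivation_def)
  note T2 = adj2(1)[OF dA dA T] and S2 = adj2(1)[OF dA dA S]
  have D2: "bounded_linear_map_on (scal A) (scal X) (level A (n + 2)) (level X (n + 3)) (adj2 A n X (n + 1) D)"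
    using adj2(1)[OF dA dX(2) _ D] dX(3) by (simp add: numeral_3_eq_3)
  have l2: "left_at A X l (n + 2) b y = arens_ext A X X n (left_at A X l n) b y"
    if "b \<in> level A (n + 2)" "y \<in> level X (n + 2)" for b y
    using ext_left_eq_arens_ext[OF dA dX(1,2) ops(2) that] by simp
  have r2: "right_at A X r (n + 2) y b = arens_ext X A X n (right_at A X r n) y b"
    if "b \<in> level A (n + 2)" "y \<in> level X (n + 2)" for b y
    using ext_right_eq_arens_ext[OF dA dX(1,2) ops(3) that] by simp
  have m2: "mult_at A m (n + 2) = arens_ext A A A n (mult_at A m n)"
    by (simp add: arens_eq_arens_ext)
  have cont: "continuous_map (weak_star_topology A (Suc n)) (weak_topology X (n + 2))
      (\<lambda>a. right_at A X r (n + 2) y (adj2 A n A n T a))" if "y \<in> level X (n + 2)" for y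
    using assms(10)[OF that] by simp
  have prod: "adj2 A n X (n + 1) D (mult_at A m (n + 2) a b) =
      dual_left X (n + 2) (right_at A X r (n + 2)) (adj2 A n A n T a) (adj2 A n X (n + 1) D b) +
      dual_right X (n + 2) (left_at A X l (n + 2)) (adj2 A n X (n + 1) D a) (adj2 A n A n S b)"
    if "a \<in> level A (n + 2)" "b \<in> level A (n + 2)" for a b
    using adj2_product_rule[OF dA dX ops T S D rule l2 r2 cont that] unfolding m2 Suc_eq_plus1 .
  show ?thesis
    unfolding TS_derivation_def
  proof (intro conjI ballI)
    show "linear_map_on (scal A) (scal A) (level A (n + 2)) (level A (n + 2)) (adj2 A n A n T)"
      and "linear_map_on (scal A) (scal A) (level A (n + 2)) (level A (n + 2)) (adj2 A n A n S)"
      using T2 S2 by (auto simp: bounded_linear_map_on_def)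
    show "continuous_on (level A (n + 2)) (adj2 A n A n T)"
      and "continuous_on (level A (n + 2)) (adj2 A n A n S)"
      using bounded_linear_map_on_continuous[OF T2 NA2] bounded_linear_map_on_continuous[OF S2 NA2] .
  qed (fact D2 prod)+
qed

end
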